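(* Let $f$ be a discrete flat surface in $\mathbb{H}^3$ defined on a domain $D\subseteq\mathbb{Z}^2$ determined by a discrete holomorphic function $g:D\to\mathbb{C}$ with properly embedded quadrilaterals, and let $C_f$ be its caustic. Let $f^d$ ($d>0$) be a parallel surface of $f$, and let $S_d$ be the set of all points $P\in\mathbb{H}^3$ such that, for some horizontal edge $\overline{pq}$ of $D$, $P$ lies in the face $\mathcal{F}_{pq}$ of $C_f$ (in its interior, on an edge, or at a vertex) and $P$ lies in the edge $\overline{f^d_pf^d_q}$ of $f^d$. Assume that no two adjacent vertices of $f^d$ are ever equal, and that the faces of $C_f$ are embedded. Then $S_d$ is a graph (in the combinatorial sense) with edges composed of geodesic segments lying in the image in $\mathbb{H}^3$ of the horizontal edges of $D$ under $f^d$, and with all vertices of $S_d$ having valence at least two.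
   Context: Domain and discrete holomorphic functions: $D$ is $\mathbb{Z}^2$ or a subdomain of it. A map $g:D\to\mathbb{C}$, with $g_q\neq g_p$ for all adjacent $p,q\in D$, is discrete holomorphic if there is a real-valued function $\alpha$ on the (unoriented) edges of $D$, called a cross ratio factorizing function, such that on each unit square $\frac{(g_{m+1,n}-g_{m,n})(g_{m,n+1}-g_{m+1,n+1})}{(g_{m+1,n+1}-g_{m+1,n})(g_{m,n}-g_{m,n+1})}=\frac{\alpha_{(m,n)(m+1,n)}}{\alpha_{(m,n)(m,n+1)}}<0$, with $\alpha_{(m,n)(m+1,n)}=\alpha_{(m,n+1)(m+1,n+1)}$ and $\alpha_{(m,n)(m,n+1)}=\alpha_{(m+1,n)(m+1,n+1)}$. Properly embedded quadrilaterals: for every unit square of $D$, the image quadrilateral in $\mathbb{C}$ with straight edges is properly embedded (a non-degenerate simple closed polygon); in particular, for a square with vertices $p,q,r,s$, $g_q-g_p\ne0$ and $g_q-g_p$, $g_s-g_p$ are not parallel. Hyperbolic space: $\mathbb{R}^{3,1}$ (metric $-dx_0^2+dx_1^2+dx_2^2+dx_3^2$) is identified with Hermitian $2\times2$ matrices $\begin{pmatrix} x_0+x_3 & x_1+ix_2\\ x_1-ix_2& x_0-x_3\end{pmatrix}$, and $\mathbb{H}^3$ is the set of such $X$ with $\det X=1$, $\mathrm{tr}\,X>0$. Discrete flat surface: given $\lambda\in\mathbb{R}\setminus\{0\}$ and $2\times 2$ complex matrices $E_p$ with $\det E_p>0$ satisfying $E_q-E_p=E_p\begin{pmatrix}0&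 g_q-g_p\\ \frac{\lambda\alpha_{pq}}{g_q-g_p}&0\end{pmatrix}$ for edges with $q=p+(1,0)$ or $q=p+(0,1)$, set $f_p=\frac{1}{\det E_p}E_p\overline{E_p}^T\in\mathbb{H}^3$ and $N_p=\frac{1}{\det E_p}E_p\begin{pmatrix}1&0\\0&-1\end{pmatrix}\overline{E_p}^T$ (the normal at $f_p$). The normal geodesic at $f_p$ is $\{\cosh t\, f_p+\sinh t\,N_p: t\in\mathbb{R}\}$. The parallel surfaces of $f$ are $f^d_p=\cosh(\log d)f_p-\sinh(\log d)N_p$, $d>0$ (with $f^1=f$). Standing convention: $\lambda\alpha_{pq}<0$ exactly on the vertical edges of $D$ (so $\lambda\alpha_{pq}>0$ on horizontal edges). For each vertical edge $pq$ the normal geodesics at $f_p$ and $f_q$ meet in exactly one point $(C_f)_{pq}\in\mathbb{H}^3$, and the caustic $C_f$ is the discrete surface with these points as vertices, defined on the grid of midpoints of vertical edges. Edges of $f$, $f^d$ and $C_f$ are the geodesic segments of $\mathbb{H}^3$ joining the images of adjacent grid points. For a horizontal edge $\overline{pq}$ of $D$, $q=p+(1,0)$, with $p^{\pm}=p\pm(0,1)$, $q^\pm=q\pm(0,1)$, the face $\mathcal{F}_{pq}$ of $C_f$ is the quadrilateral with vertices, in order, $(C_f)_{p^-p},(C_f)_{q^-q},(C_f)_{qq^+},(C_f)_{pp^+}$; it lies in the geodesic plane containing the normal geodesics at $f_p$ and $f_q$, and these normal geodesics contain two opposite edges of it. The vertices of the graph $S_d$ are in general not the vertices of $f^d$ or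 of $C_f$.
   Formalization: The literal claim fails when D has a boundary: valence at least two is stated except at ends of edges of S_d on sides of faces of C_f having no neighbouring face (none if D = Z^2). Edges are counted per horizontal edge of D, so coinciding ones count separately. *)

theory Defs
  imports "HOL-Analysis.Analysis" "HOL-Library.Extended_Nat"
begin

section \<open>Grid domains and discrete holomorphic functions\<close>

type_synonym grid = "int \<times> int"

definition h_edge :: "grid set \<Rightarrow> grid \<Rightarrow> bool" where
  "h_edge D p \<longleftrightarrow> p \<in> D \<and> p + (1, 0) \<in> D"

definition v_edge :: "grid set \<Rightarrow> grid \<Rightarrow> bool" where
  "v_edge D p \<longleftrightarrow> p \<in> D \<and> p + (0, 1) \<in> D"

definition unit_square :: "grid set \<Rightarrow> grid \<Rightarrow> bool" where
  "unit_square D p \<longleftrightarrow> p \<in> D \<and> p + (1, 0) \<in> D \<and> p + (1, 1) \<in> D \<and> p + (0, 1) \<in> D"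

definition adjacent_in :: "grid set \<Rightarrow> grid \<Rightarrow> grid \<Rightarrow> bool" where
  "adjacent_in D p q \<longleftrightarrow> p \<in> D \<and> q \<in> D \<and>
     (q = p + (1, 0) \<or> q = p + (0, 1) \<or> p = q + (1, 0) \<or> p = q + (0, 1))"

(* alpha is a function of unoriented edges: the edge joining p and q is the set {p, q}.
   Since x / 0 = 0, negativity of the quotient also gives that alpha does not vanish on the
   edges of unit squares. *)
definition discrete_holomorphic ::
  "grid set \<Rightarrow> (grid \<Rightarrow> complex) \<Rightarrow> (grid set \<Rightarrow> real) \<Rightarrow> bool" where
  "discrete_holomorphic D g \<alpha> \<longleftrightarrow>
     (\<forall>p q. adjacent_in D p q \<longrightarrow> g p \<noteq> g q) \<and>
     (\<forall>p. unit_square D p \<longrightarrow>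
        (let q = p + (1, 0); r = p + (1, 1); s = p + (0, 1) in
           ((g q - g p) * (g s - g r)) / ((g r - g q) * (g p - g s))
             = of_real (\<alpha> {p, q} / \<alpha> {p, s}) \<and>
           \<alpha> {p, q} / \<alpha> {p, s} < 0 \<and>
           \<alpha> {p, q} = \<alpha> {s, r} \<and> \<alpha> {p, s} = \<alpha> {q, r}))"

(* The closed polygon a b c d with sides given by the segments "seg" is simple: no side
   degenerates to a point, consecutive sides share only their common vertex, and opposite
   sides are disjoint. *)
definition simple_quad :: "('a \<Rightarrow> 'a \<Rightarrow> 'a set) \<Rightarrow> 'a \<Rightarrow> 'a \<Rightarrow> 'a \<Rightarrow> 'a \<Rightarrow> bool" where
  "simple_quad seg a b c d \<longleftrightarrow>
     distinct [a, b, c, d] \<and>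
     seg a b \<inter> seg b c = {b} \<and> seg b c \<inter> seg c d = {c} \<and>
     seg c d \<inter> seg d a = {d} \<and> seg d a \<inter> seg a b = {a} \<and>
     seg a b \<inter> seg c d = {} \<and> seg b c \<inter> seg d a = {}"

definition properly_embedded_quad :: "complex \<Rightarrow> complex \<Rightarrow> complex \<Rightarrow> complex \<Rightarrow> bool" where
  "properly_embedded_quad a b c d \<longleftrightarrow>
     simple_quad closed_segment a b c d \<and>
     \<not> collinear {d, a, b} \<and> \<not> collinear {a, b, c} \<and>
     \<not> collinear {b, c, d} \<and> \<not> collinear {c, d, a}"

definition properly_embedded_quads :: "grid set \<Rightarrow> (grid \<Rightarrow> complex) \<Rightarrow> bool" where
  "properly_embedded_quads D g \<longleftrightarrow>
     (\<forall>p. unit_square D p \<longrightarrow>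
        properly_embedded_quad (g p) (g (p + (1, 0))) (g (p + (1, 1))) (g (p + (0, 1))))"

section \<open>The Hermitian model of hyperbolic 3-space\<close>

type_synonym cmat = "complex ^ 2 ^ 2"

definition mat2 :: "complex \<Rightarrow> complex \<Rightarrow> complex \<Rightarrow> complex \<Rightarrow> cmat" where
  "mat2 a b c d = vector [vector [a, b], vector [c, d]]"

definition herm :: "cmat \<Rightarrow> cmat" where
  "herm A = (\<chi> i j. cnj (A $ j $ i))"

definition H3 :: "cmat set" where
  "H3 = {X. herm X = X \<and> det X = 1 \<and> 0 < Re (trace X)}"

(* Totally geodesic subspaces are the intersections of H3 with linear subspaces of R^{3,1};
   the geodesic segment XY is the central projection to H3 of the chord from X to Y. *)
definition geod_seg :: "cmat \<Rightarrow> cmat \<Rightarrow> cmat set" where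
  "geod_seg X Y = {Z \<in> H3. \<exists>a b. 0 \<le> a \<and> 0 \<le> b \<and> Z = a *\<^sub>R X + b *\<^sub>R Y}"

definition geod_quad :: "cmat \<Rightarrow> cmat \<Rightarrow> cmat \<Rightarrow> cmat \<Rightarrow> cmat set" where
  "geod_quad A B C D = geod_seg A B \<union> geod_seg B C \<union> geod_seg C D \<union> geod_seg D A"

(* For A, B, C, D in a common geodesic plane (and not on one geodesic): the polygon together
   with the region of that plane which it encloses, i.e. the bounded components of its
   complement in the plane. A subset of H3 is hyperbolically bounded iff it is bounded as a
   set of matrices. *)
definition geod_quad_region :: "cmat \<Rightarrow> cmat \<Rightarrow> cmat \<Rightarrow> cmat \<Rightarrow> cmat set" where
  "geod_quad_region A B C D =
     (let plane = span {A, B, C, D} \<inter> H3; Q = geod_quad A B C D in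
        Q \<union> {X \<in> plane - Q. bounded (connected_component_set (plane - Q) X)})"

section \<open>Discrete flat surfaces, parallel surfaces and caustics\<close>

definition flat_surface_frame ::
  "grid set \<Rightarrow> (grid \<Rightarrow> complex) \<Rightarrow> (grid set \<Rightarrow> real) \<Rightarrow> real \<Rightarrow> (grid \<Rightarrow> cmat) \<Rightarrow> bool" where
  "flat_surface_frame D g \<alpha> l E \<longleftrightarrow>
     (\<forall>p\<in>D. det (E p) \<in> \<real> \<and> 0 < Re (det (E p))) \<and>
     (\<forall>p q. p \<in> D \<and> q \<in> D \<and> (q = p + (1, 0) \<or> q = p + (0, 1)) \<longrightarrow>
        E q - E p = E p ** mat2 0 (g q - g p) (of_real (l * \<alpha> {p, q}) / (g q - g p)) 0)"

definition surf :: "(grid \<Rightarrow> cmat) \<Rightarrow> grid \<Rightarrow> cmat" where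
  "surf E p = (1 / Re (det (E p))) *\<^sub>R (E p ** herm (E p))"

definition surf_normal :: "(grid \<Rightarrow> cmat) \<Rightarrow> grid \<Rightarrow> cmat" where
  "surf_normal E p = (1 / Re (det (E p))) *\<^sub>R (E p ** mat2 1 0 0 (- 1) ** herm (E p))"

definition normal_geodesic :: "(grid \<Rightarrow> cmat) \<Rightarrow> grid \<Rightarrow> cmat set" where
  "normal_geodesic E p = {cosh t *\<^sub>R surf E p + sinh t *\<^sub>R surf_normal E p | t :: real. True}"

definition parallel_surf :: "(grid \<Rightarrow> cmat) \<Rightarrow> real \<Rightarrow> grid \<Rightarrow> cmat" where
  "parallel_surf E d p = cosh (ln d) *\<^sub>R surf E p - sinh (ln d) *\<^sub>R surf_normal E p"

(* The vertex of the caustic on the vertical edge from p to p + (0, 1). *)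
definition caustic :: "(grid \<Rightarrow> cmat) \<Rightarrow> grid \<Rightarrow> cmat" where
  "caustic E p = (THE X. X \<in> normal_geodesic E p \<inter> normal_geodesic E (p + (0, 1)))"

(* The horizontal edges of D whose caustic face has all four of its vertices defined. *)
definition caustic_face_edges :: "grid set \<Rightarrow> grid set" where
  "caustic_face_edges D =
     {p. h_edge D p \<and> v_edge D (p - (0, 1)) \<and> v_edge D (p + (1, 0) - (0, 1)) \<and>
         v_edge D (p + (1, 0)) \<and> v_edge D p}"

definition caustic_face_embedded :: "(grid \<Rightarrow> cmat) \<Rightarrow> grid \<Rightarrow> bool" where
  "caustic_face_embedded E p \<longleftrightarrow>
     simple_quad geod_seg (caustic E (p - (0, 1))) (caustic E (p + (1, 0) - (0, 1)))
       (caustic E (p + (1, 0))) (caustic E p)"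

definition caustic_face :: "(grid \<Rightarrow> cmat) \<Rightarrow> grid \<Rightarrow> cmat set" where
  "caustic_face E p =
     geod_quad_region (caustic E (p - (0, 1))) (caustic E (p + (1, 0) - (0, 1)))
       (caustic E (p + (1, 0))) (caustic E p)"

(* The union of those sides of the face at p that are not shared with a neighbouring face of
   the caustic. There are none if D is all of Z^2; if D is a proper subdomain, the set S_d is cut
   off along these sides, and a point where it ends there need not have valence two. *)
definition caustic_boundary_sides :: "grid set \<Rightarrow> (grid \<Rightarrow> cmat) \<Rightarrow> grid \<Rightarrow> cmat set" where
  "caustic_boundary_sides D E p =
     (let A = caustic E (p - (0, 1)); B = caustic E (p + (1, 0) - (0, 1));
          C = caustic E (p + (1, 0)); F = caustic E p;
          side = (\<lambda>X Y r. if r \<in> caustic_face_edges D then {} else geod_seg X Y)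
      in side A B (p - (0, 1)) \<union> side B C (p + (1, 0)) \<union>
         side C F (p + (0, 1)) \<union> side F A (p - (1, 0)))"

lemma caustic_boundary_sides_UNIV [simp]: "caustic_boundary_sides UNIV E p = {}"
  by (simp add: caustic_boundary_sides_def caustic_face_edges_def h_edge_def v_edge_def)

section \<open>The graph\<close>

definition S_part :: "(grid \<Rightarrow> cmat) \<Rightarrow> real \<Rightarrow> grid \<Rightarrow> cmat set" where
  "S_part E d p =
     caustic_face E p \<inter> geod_seg (parallel_surf E d p) (parallel_surf E d (p + (1, 0)))"

definition S_set :: "grid set \<Rightarrow> (grid \<Rightarrow> cmat) \<Rightarrow> real \<Rightarrow> cmat set" where
  "S_set D E d = {P \<in> H3. \<exists>p \<in> caustic_face_edges D. P \<in> S_part E d p}"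

(* Undirected loopless graph with vertex set V and edge set I, the edge e joining the two
   elements of "ends e"; multiple edges are allowed. *)
definition graph :: "'v set \<Rightarrow> 'e set \<Rightarrow> ('e \<Rightarrow> 'v set) \<Rightarrow> bool" where
  "graph V I ends \<longleftrightarrow> (\<forall>e\<in>I. ends e \<subseteq> V \<and> card (ends e) = 2)"

definition valence :: "'e set \<Rightarrow> ('e \<Rightarrow> 'v set) \<Rightarrow> 'v \<Rightarrow> enat" where
  "valence I ends v =
     (let J = {e \<in> I. v \<in> ends e} in if finite J then enat (card J) else \<infinity>)"

end

theory Submission
  imports Defs
begin

text \<open>
  The plane of two neighbouring normal geodesics carries a projective chart in which everything
  is elementary. Write \<open>A, B\<close> for the light-like \<open>(f + N) / 2\<close>, \<open>(f - N) / 2\<close> at \<open>p\<close>, and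
  \<open>A', B'\<close> for those at \<open>q = p + (1, 0)\<close>. With \<open>c = \<lambda>\<alpha> / |g_q - g_p|^2\<close> one has
  \<open>A - c B = A' - c B' =: U\<close>, and the point \<open>s A + B / s\<close> of the normal geodesic at \<open>p\<close> is
  proportional to \<open>\<psi>(s) U + B\<close>, where \<open>\<psi>(s) = s^2 / (1 + c s^2)\<close>; likewise at \<open>q\<close> with \<open>B'\<close>
  in place of \<open>B\<close>. In the coordinates \<open>(w, t)\<close> of \<open>w U + (1 - t) B + t B'\<close> the edge of the
  parallel surface is the line \<open>w = \<psi>(1 / d)\<close>, \<open>0 \<le> t \<le> 1\<close>, and the face of the caustic is a
  trapezoid with its parallel sides on \<open>t = 0\<close> and \<open>t = 1\<close>. A caustic vertex has the same
  parameter on both normal geodesics through it, so if the parallel surface passed through it, two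
  adjacent vertices would coincide. Hence the line avoids the vertices of the trapezoid, and meets
  it either not at all or in a segment joining two of its sides. The point where a side is crossed
  depends only on the end points of that side and their parameters, not on the face, so that the
  segment is continued in the face on the other side.
\<close>

section \<open>Normal geodesics and light rays\<close>

lemma mat2_nth [simp]:
  "mat2 a b c d $ 1 $ 1 = a" "mat2 a b c d $ 1 $ 2 = b"
  "mat2 a b c d $ 2 $ 1 = c" "mat2 a b c d $ 2 $ 2 = d"
  by (simp_all add: mat2_def)

lemma cmat_eq_iff: "A = B \<longleftrightarrow> A $ 1 $ 1 = B $ 1 $ 1 \<and> A $ 1 $ 2 = B $ 1 $ 2 \<and>
    A $ 2 $ 1 = B $ 2 $ 1 \<and> A $ 2 $ 2 = B $ 2 $ 2" for A B :: cmat
  by (auto simp: vec_eq_iff forall_2)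

lemma herm_nth [simp]: "herm A $ i $ j = cnj (A $ j $ i)"
  by (simp add: herm_def)

lemma scaleR_complex: "r *\<^sub>R z = of_real r * z" for z :: complex
  by (rule scaleR_conv_of_real)

lemma cmat_mult_nth: "(A ** B) $ i $ j = A $ i $ 1 * B $ 1 $ j + A $ i $ 2 * B $ 2 $ j" for A B :: cmat
  by (simp add: matrix_matrix_mult_def sum_2)

lemma trace_cmat: "trace A = A $ 1 $ 1 + A $ 2 $ 2" for A :: cmat
  by (simp add: trace_def sum_2)

lemma herm_add: "herm (A + B) = herm A + herm B"
  by (simp add: herm_def vec_eq_iff)

lemma herm_scaleR: "herm (r *\<^sub>R A) = r *\<^sub>R herm A"
  by (simp add: herm_def vec_eq_iff)

lemma herm_mult: "herm (A ** B) = herm B ** herm A"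
  by (simp add: cmat_eq_iff cmat_mult_nth algebra_simps)

lemma herm_herm [simp]: "herm (herm A) = A"
  by (simp add: cmat_eq_iff)

lemma det_herm: "det (herm A) = cnj (det A)"
  by (simp add: det_2)

lemma trace_add_cmat: "trace (A + B) = trace A + trace B" for A B :: cmat
  by (simp add: trace_cmat)

lemma trace_scaleR_cmat: "trace (r *\<^sub>R A) = r *\<^sub>R trace A" for A :: cmat
  by (simp add: trace_cmat scaleR_right_distrib)

lemma det_scaleR_cmat: "det (r *\<^sub>R A) = of_real (r\<^sup>2) * det A" for A :: cmat
  by (simp add: det_2 scaleR_complex power2_eq_square algebra_simps)

section \<open>The isometry of the Hermitian model given by a frame\<close>

definition pos_det :: "cmat \<Rightarrow> bool" where
  "pos_det E \<longleftrightarrow> det E \<in> \<real> \<and> 0 < Re (det E)"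

text \<open>The action of a frame on Hermitian matrices, normalised so that it preserves the
  determinant and hence the Minkowski metric. The surface point and its normal are the images of the
  identity and of diag(1, -1).\<close>

definition sandwich :: "cmat \<Rightarrow> cmat \<Rightarrow> cmat" where
  "sandwich E Y = (1 / Re (det E)) *\<^sub>R (E ** Y ** herm E)"

lemma sandwich_add: "sandwich E (X + Y) = sandwich E X + sandwich E Y"
  by (simp add: sandwich_def cmat_eq_iff cmat_mult_nth algebra_simps scaleR_complex)

lemma sandwich_scaleR: "sandwich E (r *\<^sub>R X) = r *\<^sub>R sandwich E X"
  by (simp add: sandwich_def cmat_eq_iff cmat_mult_nth algebra_simps scaleR_complex)

lemma pos_det_of_real: "pos_det E \<Longrightarrow> det E = of_real (Re (det E))"
  by (simp add: pos_det_def)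

lemma det_sandwich:
  assumes "pos_det E" shows "det (sandwich E Y) = det Y"
proof -
  define r where "r = Re (det E)"
  have r: "det E = of_real r" "r > 0" using assms pos_det_of_real by (auto simp: r_def pos_det_def)
  have "det (sandwich E Y) = of_real ((1 / r)\<^sup>2) * (det E * det Y * cnj (det E))"
    unfolding sandwich_def r_def by (simp only: det_scaleR_cmat det_mul det_herm)
  also have "\<dots> = det Y" using r by (simp add: power2_eq_square)
  finally show ?thesis .
qed

lemma herm_sandwich: "herm (sandwich E Y) = sandwich E (herm Y)"
  by (simp add: sandwich_def herm_scaleR herm_mult matrix_mul_assoc)

text \<open>Lets the objects at the far end of an edge be computed in the frame at the near end:
  only the step matrix \<open>M\<close> and the factor \<open>1 / r\<close> remain.\<close>

lemma sandwich_mult: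
  assumes "pos_det E" "det M = of_real r" "r \<noteq> 0"
  shows "sandwich (E ** M) Y = sandwich E ((1 / r) *\<^sub>R (M ** Y ** herm M))"
proof -
  have "Re (det (E ** M)) = Re (det E) * r"
    using assms by (simp add: det_mul)
  then show ?thesis
    by (simp add: sandwich_scaleR) (simp add: sandwich_def herm_mult matrix_mul_assoc)
qed

lemma sandwich_inj:
  assumes "pos_det E" "sandwich E X = sandwich E Y" shows "X = Y"
proof -
  have d: "det E \<noteq> 0" "Re (det E) \<noteq> 0" using assms(1) by (auto simp: pos_det_def)
  have "det (herm E) \<noteq> 0" using d by (simp add: det_herm)
  with d obtain F G where F: "F ** E = mat 1" and G: "herm E ** G = mat 1"
    by (meson invertible_def invertible_det_nz)
  have "E ** X ** herm E = E ** Y ** herm E"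
    using assms(2) d by (simp add: sandwich_def)
  then have "F ** (E ** X ** herm E) ** G = F ** (E ** Y ** herm E) ** G" by simp
  moreover have "F ** (E ** Z ** herm E) ** G = Z" for Z
  proof -
    have "F ** (E ** Z ** herm E) ** G = (F ** E) ** Z ** (herm E ** G)"
      by (simp only: matrix_mul_assoc)
    then show ?thesis by (simp add: F G)
  qed
  ultimately show ?thesis by simp
qed

text \<open>The normal geodesic at \<open>f_p\<close> ends at the light rays of \<open>f_p + N_p\<close> and \<open>f_p - N_p\<close>.\<close>

definition light_plus :: "cmat \<Rightarrow> cmat" where "light_plus E = sandwich E (mat2 1 0 0 0)"
definition light_minus :: "cmat \<Rightarrow> cmat" where "light_minus E = sandwich E (mat2 0 0 0 1)"

text \<open>The parameter is the exponential of arc length: cosh t f + sinh t N has parameter s =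
  exp t. A parallel surface therefore has one and the same parameter 1/d on all normal
  geodesics.\<close>

definition normal_point :: "cmat \<Rightarrow> real \<Rightarrow> cmat" where
  "normal_point E s = s *\<^sub>R light_plus E + (1 / s) *\<^sub>R light_minus E"

lemma normal_point_sandwich:
  "normal_point E s = sandwich E (mat2 (of_real s) 0 0 (of_real (1 / s)))"
proof -
  have "mat2 (of_real s) 0 0 (of_real (1 / s)) = s *\<^sub>R mat2 1 0 0 0 + (1 / s) *\<^sub>R mat2 0 0 0 1"
    by (simp add: cmat_eq_iff scaleR_complex)
  then show ?thesis
    by (simp add: normal_point_def light_plus_def light_minus_def sandwich_add sandwich_scaleR)
qed

lemma surf_eq: "surf E p = light_plus (E p) + light_minus (E p)"
proof -
  have "mat2 1 0 0 0 + mat2 0 0 0 1 = mat 1" by (simp add: cmat_eq_iff mat_def)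
  then have "light_plus (E p) + light_minus (E p) = sandwich (E p) (mat 1)"
    by (simp add: light_plus_def light_minus_def flip: sandwich_add)
  then show ?thesis by (simp add: sandwich_def surf_def)
qed

lemma surf_normal_eq: "surf_normal E p = light_plus (E p) - light_minus (E p)"
proof -
  have "mat2 1 0 0 (-1) = mat2 1 0 0 0 + (-1) *\<^sub>R mat2 0 0 0 1" by (simp add: cmat_eq_iff)
  then have "sandwich (E p) (mat2 1 0 0 (-1)) = light_plus (E p) + (-1) *\<^sub>R light_minus (E p)"
    by (simp only: light_plus_def light_minus_def sandwich_add sandwich_scaleR)
  then show ?thesis by (simp add: sandwich_def surf_normal_def)
qed

lemma cosh_sinh_surf:
  "cosh t *\<^sub>R surf E p + sinh t *\<^sub>R surf_normal E p = normal_point (E p) (exp t)"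
proof -
  have "cosh t *\<^sub>R surf E p + sinh t *\<^sub>R surf_normal E p =
      (cosh t + sinh t) *\<^sub>R light_plus (E p) + (cosh t - sinh t) *\<^sub>R light_minus (E p)"
    by (simp add: surf_eq surf_normal_eq algebra_simps)
  then show ?thesis
    by (simp add: cosh_plus_sinh cosh_minus_sinh normal_point_def exp_minus field_simps)
qed

lemma normal_geodesic_eq: "normal_geodesic E p = normal_point (E p) ` {0<..}"
proof -
  have "normal_geodesic E p = range (\<lambda>t. normal_point (E p) (exp t))"
    by (auto simp: normal_geodesic_def cosh_sinh_surf)
  also have "\<dots> = normal_point (E p) ` range exp" by (simp add: image_image)
  also have "range exp = {0::real<..}"
    by (auto simp: image_iff) (metis exp_ln)
  finally show ?thesis .
qed

lemma parallel_surf_eq: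
  assumes "d > 0" shows "parallel_surf E d p = normal_point (E p) (1 / d)"
  using cosh_sinh_surf[of "- ln d" E p] assms
  by (simp add: parallel_surf_def exp_minus inverse_eq_divide)

text \<open>Each trace is the squared length of a column of \<open>E\<close> divided by
  \<open>det E\<close>, and no column of an invertible matrix vanishes.\<close>

lemma trace_light:
  assumes "pos_det E"
  shows "0 < Re (trace (light_plus E))" "0 < Re (trace (light_minus E))"
proof -
  have d: "Re (det E) > 0" using assms by (simp add: pos_det_def)
  have ne: "E $ 1 $ 1 \<noteq> 0 \<or> E $ 2 $ 1 \<noteq> 0" "E $ 1 $ 2 \<noteq> 0 \<or> E $ 2 $ 2 \<noteq> 0"
    using d by (auto simp: det_2)
  have "Re (trace (light_plus E)) = (1 / Re (det E)) * ((cmod (E $ 1 $ 1))\<^sup>2 + (cmod (E $ 2 $ 1))\<^sup>2)"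
    unfolding cmod_power2
    by (simp add: light_plus_def sandwich_def trace_cmat cmat_mult_nth scaleR_complex
        power2_eq_square algebra_simps add_divide_distrib)
  moreover have "(cmod (E $ 1 $ 1))\<^sup>2 + (cmod (E $ 2 $ 1))\<^sup>2 > 0"
    using ne(1) by (auto simp: add_pos_nonneg add_nonneg_pos)
  ultimately show "0 < Re (trace (light_plus E))" using d by simp
  have "Re (trace (light_minus E)) = (1 / Re (det E)) * ((cmod (E $ 1 $ 2))\<^sup>2 + (cmod (E $ 2 $ 2))\<^sup>2)"
    unfolding cmod_power2
    by (simp add: light_minus_def sandwich_def trace_cmat cmat_mult_nth scaleR_complex
        power2_eq_square algebra_simps add_divide_distrib)
  moreover have "(cmod (E $ 1 $ 2))\<^sup>2 + (cmod (E $ 2 $ 2))\<^sup>2 > 0"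
    using ne(2) by (auto simp: add_pos_nonneg add_nonneg_pos)
  ultimately show "0 < Re (trace (light_minus E))" using d by simp
qed

section \<open>Light rays at the two ends of an edge, seen from one frame\<close>

context
  fixes E :: cmat and h :: complex and \<kappa> :: real
  assumes E: "pos_det E" and h: "h \<noteq> 0" and \<kappa>: "\<kappa> < 1"
begin

text \<open>The frame at the far end of an edge, where h is the difference of g along the edge and
  \<kappa> stands for \<lambda>\<alpha>. The step matrix has determinant 1 - \<kappa>, which is the
  source of the factor 1/(1 - \<kappa>) below.\<close>

abbreviation (input) "next_frame \<equiv> E ** mat2 1 h (of_real \<kappa> / h) 1"

lemma sandwich_step:
  "sandwich next_frame Y = sandwich E ((1 / (1 - \<kappa>)) *\<^sub>R
     (mat2 1 h (of_real \<kappa> / h) 1 ** Y ** herm (mat2 1 h (of_real \<kappa> / h) 1)))"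
  by (rule sandwich_mult[OF E]) (use h \<kappa> in \<open>auto simp: det_2\<close>)

lemma cnj_quot: "cnj (of_real \<kappa> / h) = of_real (\<kappa> / (cmod h)\<^sup>2) * h"
  using h by (simp add: complex_norm_square field_simps del: of_real_power)

text \<open>The matrix on the right is the rank one Hermitian matrix built from the second column
  (h, 1) of the step matrix; \<open>light_plus_step\<close> does the same with the first column (1,
  \<kappa>/h).\<close>

lemma light_minus_step:
  "light_minus next_frame = (1 / (1 - \<kappa>)) *\<^sub>R
     sandwich E (mat2 (of_real ((cmod h)\<^sup>2)) h (cnj h) 1)"
  unfolding light_minus_def sandwich_step sandwich_scaleR complex_norm_square
  by (rule arg_cong[where f = "\<lambda>Y. _ *\<^sub>R sandwich E Y"])
    (simp add: cmat_eq_iff cmat_mult_nth)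

lemma light_plus_step:
  "light_plus next_frame = (1 / (1 - \<kappa>)) *\<^sub>R sandwich E
     (mat2 1 (of_real (\<kappa> / (cmod h)\<^sup>2) * h)
        (of_real (\<kappa> / (cmod h)\<^sup>2) * cnj h) (of_real (\<kappa>\<^sup>2 / (cmod h)\<^sup>2)))"
proof -
  have 1: "cnj (of_real \<kappa> / h) = of_real (\<kappa> / (cmod h)\<^sup>2) * h" by (rule cnj_quot)
  have 2: "of_real \<kappa> / h = of_real (\<kappa> / (cmod h)\<^sup>2) * cnj h"
    using arg_cong[OF 1, of cnj] by simp
  have 3: "h * cnj h = of_real ((cmod h)\<^sup>2)" by (rule complex_norm_square[symmetric])
  have 4: "cmod h \<noteq> 0" using h by simp
  have "of_real \<kappa> / h * cnj (of_real \<kappa> / h) = of_real (\<kappa> / (cmod h)\<^sup>2 * (\<kappa> / (cmod h)\<^sup>2)) * (h * cnj h)"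
    unfolding 1 2 by simp
  also have "\<dots> = of_real (\<kappa>\<^sup>2 / (cmod h)\<^sup>2)"
    unfolding 3 of_real_mult[symmetric] using 4
    by (intro arg_cong[where f = of_real]) (simp add: field_simps power2_eq_square)
  finally have 5: "of_real \<kappa> / h * cnj (of_real \<kappa> / h) = of_real (\<kappa>\<^sup>2 / (cmod h)\<^sup>2)" .
  have "mat2 1 h m 1 ** mat2 1 0 0 0 ** herm (mat2 1 h m 1) = mat2 1 (cnj m) m (m * cnj m)" for m
    by (simp add: cmat_eq_iff cmat_mult_nth)
  note * = this[of "of_real \<kappa> / h", unfolded 5, unfolded 1]
  show ?thesis
    unfolding light_plus_def sandwich_step sandwich_scaleR * by (simp only: 2)
qed

end

text \<open>In the frame \<open>E\<close> the off-diagonal entries of the two light rays of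
  \<open>F\<close> are n c h and n h up to conjugation, so they cancel in the difference; the
  diagonal becomes 1 and -c because n (1 - \<kappa>) = 1. The common vector U shows that the four
  light rays span at most three dimensions, i.e. that the two normal geodesics are coplanar.\<close>

lemma light_step_eq:
  fixes E :: cmat
  assumes E: "pos_det E" and h: "h \<noteq> 0" and \<kappa>: "\<kappa> < 1"
  defines "c \<equiv> \<kappa> / (cmod h)\<^sup>2" and "F \<equiv> E ** mat2 1 h (of_real \<kappa> / h) 1"
  shows "light_plus F - c *\<^sub>R light_minus F = light_plus E - c *\<^sub>R light_minus E"
proof -
  define n where "n = 1 / (1 - \<kappa>)"
  have c: "c * (cmod h)\<^sup>2 = \<kappa>" "\<kappa>\<^sup>2 / (cmod h)\<^sup>2 = \<kappa> * c"
    using h by (auto simp: c_def power2_eq_square)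
  have n: "n - n * \<kappa> = 1" using \<kappa> by (simp add: n_def field_simps)
  have 1: "n * (1 - c * (cmod h)\<^sup>2) = 1" using n by (simp add: c(1) algebra_simps)
  have 2: "n * (\<kappa> * c - c) = - c * (n - n * \<kappa>)" by (simp add: algebra_simps)
  have "light_plus F + (- c) *\<^sub>R light_minus F = sandwich E (n *\<^sub>R
      (mat2 1 (of_real c * h) (of_real c * cnj h) (of_real (\<kappa> * c)) +
       (- c) *\<^sub>R mat2 (of_real ((cmod h)\<^sup>2)) h (cnj h) 1))"
    unfolding F_def light_plus_step[OF E h \<kappa>] light_minus_step[OF E h \<kappa>] c(2) c_def[symmetric]
      n_def[symmetric] sandwich_add sandwich_scaleR by (simp add: algebra_simps)
  also have "n *\<^sub>R (mat2 1 (of_real c * h) (of_real c * cnj h) (of_real (\<kappa> * c)) +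
       (- c) *\<^sub>R mat2 (of_real ((cmod h)\<^sup>2)) h (cnj h) 1) =
     mat2 (of_real (n * (1 - c * (cmod h)\<^sup>2))) 0 0 (of_real (n * (\<kappa> * c - c)))"
    by (simp add: cmat_eq_iff scaleR_complex)
  also have "\<dots> = mat2 1 0 0 0 + (- c) *\<^sub>R mat2 0 0 0 1"
    unfolding 1 2 n by (simp add: cmat_eq_iff scaleR_complex)
  finally have "light_plus F + (- c) *\<^sub>R light_minus F = light_plus E + (- c) *\<^sub>R light_minus E"
    unfolding sandwich_add sandwich_scaleR by (simp add: light_plus_def light_minus_def)
  then show ?thesis by simp
qed

text \<open>The Minkowski form, up to sign, in the vectors U, B, B' of the common plane: B and B'
  are light-like, pair equally with U, and their mutual pairing is governed by |h|^2 / (1 -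
  \<kappa>).\<close>

lemma det_light_span:
  fixes E :: cmat
  assumes E: "pos_det E" and h: "h \<noteq> 0" and \<kappa>: "\<kappa> < 1"
  defines "c \<equiv> \<kappa> / (cmod h)\<^sup>2" and "F \<equiv> E ** mat2 1 h (of_real \<kappa> / h) 1"
  shows "det (x *\<^sub>R (light_plus E - c *\<^sub>R light_minus E) + y *\<^sub>R light_minus E + z *\<^sub>R light_minus F) =
    of_real (x * (y + z) - c * x\<^sup>2 + (cmod h)\<^sup>2 / (1 - \<kappa>) * y * z)"
proof -
  define k where "k = (cmod h)\<^sup>2 / (1 - \<kappa>)"
  define n where "n = 1 / (1 - \<kappa>)"
  have kn: "k = (cmod h)\<^sup>2 * n" by (simp add: k_def n_def)
  have n: "n - n * \<kappa> = 1" using \<kappa> by (simp add: n_def field_simps)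
  have ck: "c * (cmod h)\<^sup>2 = \<kappa>" using h by (simp add: c_def)
  have "x *\<^sub>R (light_plus E - c *\<^sub>R light_minus E) + y *\<^sub>R light_minus E + z *\<^sub>R light_minus F =
     x *\<^sub>R light_plus E + (y - x * c) *\<^sub>R light_minus E + z *\<^sub>R light_minus F"
    by (simp add: algebra_simps)
  also have "\<dots> = sandwich E (mat2 (of_real (x + z * k)) (of_real (z * n) * h)
       (of_real (z * n) * cnj h) (of_real (y - x * c + z * n)))"
    unfolding F_def light_minus_step[OF E h \<kappa>]
    unfolding light_plus_def light_minus_def sandwich_add[symmetric] sandwich_scaleR[symmetric]
    by (rule arg_cong[where f = "sandwich E"])
      (simp add: cmat_eq_iff scaleR_complex kn n_def)
  finally have "det (x *\<^sub>R (light_plus E - c *\<^sub>R light_minus E) + y *\<^sub>R light_minus E + z *\<^sub>R light_minus F) =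
     of_real (x + z * k) * of_real (y - x * c + z * n) - of_real (z * n * (z * n)) * (h * cnj h)"
    by (simp add: det_sandwich[OF E]) (simp add: det_2)
  also have "h * cnj h = of_real ((cmod h)\<^sup>2)" by (rule complex_norm_square[symmetric])
  also have "of_real (x + z * k) * of_real (y - x * c + z * n) - of_real (z * n * (z * n)) * of_real ((cmod h)\<^sup>2) =
     (of_real ((x + z * k) * (y - x * c + z * n) - z * n * (z * n) * (cmod h)\<^sup>2) :: complex)"
    by simp
  \<comment> \<open>The last summand is isolated because it vanishes: c |h|^2 = \<kappa> and n - n
    \<kappa> = 1.\<close>
  also have "(x + z * k) * (y - x * c + z * n) - z * n * (z * n) * (cmod h)\<^sup>2 =
      x * (y + z) - c * x\<^sup>2 + k * y * z + x * z * (n - n * (c * (cmod h)\<^sup>2) - 1)"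
    unfolding kn by (simp add: algebra_simps power2_eq_square)
  finally show ?thesis using n by (simp add: ck k_def)
qed

text \<open>In the frame \<open>E\<close> the normal geodesic at the near end consists of diagonal
  matrices. The off-diagonal entry (t c + 1/t) h of the other one vanishes only for t^2 = -1/c =
  \<sigma>^2, which needs \<kappa> < 0; the diagonal entries then give s = \<sigma> as well.\<close>

lemma normal_points_meet:
  fixes E :: cmat
  assumes E: "pos_det E" and h: "h \<noteq> 0" and \<kappa>: "\<kappa> < 0" and s: "s > 0" "t > 0"
  defines "\<sigma> \<equiv> cmod h / sqrt (- \<kappa>)"
  shows "normal_point E s = normal_point (E ** mat2 1 h (of_real \<kappa> / h) 1) t \<longleftrightarrow> s = \<sigma> \<and> t = \<sigma>"
proof -
  define c where "c = \<kappa> / (cmod h)\<^sup>2"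
  define n where "n = 1 / (1 - \<kappa>)"
  have \<kappa>1: "\<kappa> < 1" using \<kappa> by simp
  have \<sigma>: "\<sigma> > 0" "\<sigma>\<^sup>2 = - (cmod h)\<^sup>2 / \<kappa>" 
    using h \<kappa> by (auto simp: \<sigma>_def power_divide)
  have c: "c = - 1 / \<sigma>\<^sup>2" using h \<kappa> by (simp add: c_def \<sigma>(2) field_simps)
  have hh: "(cmod h)\<^sup>2 = - \<kappa> * \<sigma>\<^sup>2" using \<kappa> \<sigma> by simp
  have "normal_point (E ** mat2 1 h (of_real \<kappa> / h) 1) t = sandwich E
     (mat2 (of_real (n * (t + (cmod h)\<^sup>2 / t))) (of_real (n * (t * c + 1 / t)) * h)
      (of_real (n * (t * c + 1 / t)) * cnj h) (of_real (n * (t * \<kappa>\<^sup>2 / (cmod h)\<^sup>2 + 1 / t))))"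
    unfolding normal_point_def light_plus_step[OF E h \<kappa>1] light_minus_step[OF E h \<kappa>1]
    unfolding sandwich_add[symmetric] sandwich_scaleR[symmetric]
    by (rule arg_cong[where f = "sandwich E"])
      (simp add: cmat_eq_iff scaleR_complex n_def c_def ring_distribs mult_ac)
  moreover have "sandwich E X = sandwich E Y \<longleftrightarrow> X = Y" for X Y
    using sandwich_inj[OF E] by blast
  ultimately have "normal_point E s = normal_point (E ** mat2 1 h (of_real \<kappa> / h) 1) t \<longleftrightarrow>
      s = n * (t + (cmod h)\<^sup>2 / t) \<and> n * (t * c + 1 / t) = 0 \<and> 1 / s = n * (t * \<kappa>\<^sup>2 / (cmod h)\<^sup>2 + 1 / t)"
    unfolding normal_point_sandwich using h
    by (auto simp: cmat_eq_iff simp del: of_real_add of_real_mult of_real_divide of_real_power)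
  also have "n * (t * c + 1 / t) = 0 \<longleftrightarrow> t = \<sigma>"
  proof -
    have "n \<noteq> 0" using \<kappa> by (simp add: n_def)
    then have "n * (t * c + 1 / t) = 0 \<longleftrightarrow> t\<^sup>2 = \<sigma>\<^sup>2"
      using s \<sigma>(1) by (auto simp add: c field_simps power2_eq_square)
    then show ?thesis using s \<sigma>(1) by (simp add: power2_eq_iff)
  qed
  also have "s = n * (t + (cmod h)\<^sup>2 / t) \<and> t = \<sigma> \<and> 1 / s = n * (t * \<kappa>\<^sup>2 / (cmod h)\<^sup>2 + 1 / t) \<longleftrightarrow> s = \<sigma> \<and> t = \<sigma>"
  proof -
    have "n * (\<sigma> + (cmod h)\<^sup>2 / \<sigma>) = \<sigma>"
      using \<sigma>(1) \<kappa> unfolding hh n_def by (simp add: field_simps power2_eq_square)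
    moreover have "n * (\<sigma> * \<kappa>\<^sup>2 / (cmod h)\<^sup>2 + 1 / \<sigma>) = 1 / \<sigma>"
      using \<sigma>(1) \<kappa> unfolding hh n_def by (simp add: field_simps power2_eq_square)
    ultimately show ?thesis by auto
  qed
  finally show ?thesis .
qed

section \<open>Geodesic segments and rays\<close>

definition future :: "cmat \<Rightarrow> bool" where
  "future X \<longleftrightarrow> herm X = X \<and> 0 < Re (det X) \<and> 0 < Re (trace X)"

text \<open>Central projection of the open future light cone onto hyperbolic space.\<close>

definition hnorm :: "cmat \<Rightarrow> cmat" where
  "hnorm X = (1 / sqrt (Re (det X))) *\<^sub>R X"

lemma H3_iff: "X \<in> H3 \<longleftrightarrow> future X \<and> Re (det X) = 1"
proof -
  have "Im (det X) = 0" if "herm X = X"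
    using det_herm[of X] that by (metis Im_complex_of_real Reals_cnj_iff Reals_cases)
  then show ?thesis by (auto simp: H3_def future_def complex_eq_iff)
qed

lemma Re_det_scaleR: "Re (det (r *\<^sub>R A)) = r\<^sup>2 * Re (det A)" for A :: cmat
  unfolding det_scaleR_cmat by (simp del: of_real_power)

lemma hnorm_H3: "future X \<Longrightarrow> hnorm X \<in> H3"
  by (simp add: H3_iff future_def hnorm_def herm_scaleR Re_det_scaleR trace_scaleR_cmat power_divide)

lemma hnorm_id: "X \<in> H3 \<Longrightarrow> hnorm X = X"
proof -
  assume "X \<in> H3"
  then have "Re (det X) = 1" by (simp only: H3_iff)
  then show ?thesis by (simp only: hnorm_def) simp
qed

lemma hnorm_scaleR: "r > 0 \<Longrightarrow> hnorm (r *\<^sub>R X) = hnorm X"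
  by (simp add: hnorm_def Re_det_scaleR real_sqrt_mult)

lemma hnorm_eq_scaleR:
  assumes "future X" obtains r where "r > 0" "hnorm X = r *\<^sub>R X"
  using assms by (intro that[of "1 / sqrt (Re (det X))"]) (auto simp: hnorm_def future_def)

lemma geod_seg_commute: "geod_seg X Y = geod_seg Y X"
proof -
  have "(\<exists>a b. 0 \<le> a \<and> 0 \<le> b \<and> Z = a *\<^sub>R X + b *\<^sub>R Y) \<longleftrightarrow>
      (\<exists>b a. 0 \<le> b \<and> 0 \<le> a \<and> Z = b *\<^sub>R Y + a *\<^sub>R X)" for Z
    by (subst ex_comm) (simp only: add.commute conj_left_commute)
  then show ?thesis unfolding geod_seg_def by simp
qed

lemma geod_seg_ends: "X \<in> H3 \<Longrightarrow> X \<in> geod_seg X Y"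
  unfolding geod_seg_def by (rule CollectI, rule conjI, assumption, rule exI[of _ 1], rule exI[of _ 0]) simp

text \<open>Allows end points to be given by unnormalised representatives: dividing a nonnegative
  combination by its total weight yields a point of the chord, and \<open>hnorm\<close> forgets that
  factor. The total weight is not zero since the zero matrix is not in \<open>H3\<close>.\<close>

lemma geod_seg_hnorm:
  assumes fut: "\<And>r. r \<in> {0..1} \<Longrightarrow> future ((1 - r) *\<^sub>R X + r *\<^sub>R Y)"
  shows "geod_seg (hnorm X) (hnorm Y) = (\<lambda>r. hnorm ((1 - r) *\<^sub>R X + r *\<^sub>R Y)) ` {0..1}"
proof -
  obtain a where a: "a > 0" "hnorm X = a *\<^sub>R X" using hnorm_eq_scaleR fut[of 0] by auto
  obtain b where b: "b > 0" "hnorm Y = b *\<^sub>R Y" using hnorm_eq_scaleR fut[of 1] by auto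
  show ?thesis
  proof (intro set_eqI iffI)
    fix Z assume "Z \<in> geod_seg (hnorm X) (hnorm Y)"
    then obtain x y where Z: "Z \<in> H3" "x \<ge> 0" "y \<ge> 0" "Z = (x * a) *\<^sub>R X + (y * b) *\<^sub>R Y"
      using a b by (auto simp: geod_seg_def)
    define s where "s = x * a + y * b"
    have "s \<noteq> 0"
    proof
      assume "s = 0"
      then have xy: "x * a = 0" "y * b = 0" using Z a b by (auto simp: s_def add_nonneg_eq_0_iff)
      have "Z = 0" unfolding Z(4) xy by simp
      then show False using Z(1) by (simp add: H3_def det_2)
    qed
    moreover have "s \<ge> 0" using Z a b by (simp add: s_def)
    ultimately have s: "s > 0" by simp
    define r where "r = y * b / s"
    have r: "r \<in> {0..1}" using Z a b s by (simp add: r_def s_def)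
    have "1 - r = x * a / s" using s by (simp add: r_def s_def field_simps)
    then have "Z = s *\<^sub>R ((1 - r) *\<^sub>R X + r *\<^sub>R Y)"
      using s by (simp add: Z(4) scaleR_add_right r_def)
    then have "Z = hnorm ((1 - r) *\<^sub>R X + r *\<^sub>R Y)"
      using hnorm_id[OF Z(1)] hnorm_scaleR[OF s] by metis
    then show "Z \<in> (\<lambda>r. hnorm ((1 - r) *\<^sub>R X + r *\<^sub>R Y)) ` {0..1}" using r by auto
  next
    fix Z assume "Z \<in> (\<lambda>r. hnorm ((1 - r) *\<^sub>R X + r *\<^sub>R Y)) ` {0..1}"
    then obtain r where r: "0 \<le> r" "r \<le> 1" and Z: "Z = hnorm ((1 - r) *\<^sub>R X + r *\<^sub>R Y)" by auto
    have f: "future ((1 - r) *\<^sub>R X + r *\<^sub>R Y)" using fut r by simp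
    then obtain e where e: "e > 0" "Z = e *\<^sub>R ((1 - r) *\<^sub>R X + r *\<^sub>R Y)"
      using hnorm_eq_scaleR Z by metis
    have "Z = (e * (1 - r) / a) *\<^sub>R hnorm X + (e * r / b) *\<^sub>R hnorm Y"
      using a b e(2) by (simp add: scaleR_add_right)
    moreover have "0 \<le> e * (1 - r) / a" "0 \<le> e * r / b" using a b e r by auto
    moreover have "Z \<in> H3" using hnorm_H3[OF f] Z by simp
    ultimately show "Z \<in> geod_seg (hnorm X) (hnorm Y)"
      unfolding geod_seg_def by blast
  qed
qed

lemma geod_quad_region_reverse: "geod_quad_region X Y Z W = geod_quad_region W Z Y X"
proof -
  have "geod_quad X Y Z W = geod_quad W Z Y X"
    unfolding geod_quad_def geod_seg_commute[of W Z] geod_seg_commute[of Z Y]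
      geod_seg_commute[of Y X] geod_seg_commute[of X W] by blast
  moreover have "{X, Y, Z, W} = {W, Z, Y, X}" by blast
  ultimately show ?thesis unfolding geod_quad_region_def by simp
qed

text \<open>A path that escapes to infinity towards the ideal point \<open>N\<close>, used to show
  that a point lies in an unbounded component. The matrix grows linearly in r, while the normalising
  factor only divides by the square root of 1 + r e.\<close>

lemma geod_ray:
  assumes X: "X \<in> H3" and N: "herm N = N" "0 < Re (trace N)" and e: "e > 0"
    and det: "\<And>r. r \<ge> 0 \<Longrightarrow> Re (det (X + r *\<^sub>R N)) = 1 + r * e"
  defines "R \<equiv> (\<lambda>r. hnorm (X + r *\<^sub>R N)) ` {0..}"
  shows "R \<subseteq> H3" "X \<in> R" "connected R" "\<not> bounded R"
proof -
  have fut: "future (X + r *\<^sub>R N)" if "r \<ge> 0" for r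
  proof -
    have X': "herm X = X" "0 < Re (trace X)" using X unfolding H3_def by blast+
    have "herm (X + r *\<^sub>R N) = X + r *\<^sub>R N" by (simp only: herm_add herm_scaleR X' N)
    moreover have "0 < Re (trace (X + r *\<^sub>R N))"
    proof -
      have "Re (trace (X + r *\<^sub>R N)) = Re (trace X) + r * Re (trace N)"
        by (simp add: trace_add_cmat trace_scaleR_cmat)
      then show ?thesis using X'(2) N(2) that by (simp add: add_pos_nonneg)
    qed
    moreover have "0 < Re (det (X + r *\<^sub>R N))"
      using det[OF that] that e by (simp only: add_pos_nonneg mult_nonneg_nonneg less_imp_le zero_less_one)
    ultimately show ?thesis unfolding future_def by blast
  qed
  then show "R \<subseteq> H3" by (auto simp: R_def hnorm_H3)
  show "X \<in> R" using hnorm_id[OF X] by (auto simp: R_def intro!: image_eqI[of _ _ 0])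
  have R: "R = (\<lambda>r. (1 / sqrt (1 + r * e)) *\<^sub>R (X + r *\<^sub>R N)) ` {0..}"
    unfolding R_def by (intro image_cong) (auto simp: hnorm_def det)
  have pos: "1 + r * e > 0" if "r \<ge> 0" for r using that e by (simp add: add_pos_nonneg)
  have ne: "sqrt (1 + r * e) \<noteq> 0" if "r \<in> {0..}" for r
    using real_sqrt_gt_zero[OF pos[of r]] that by fastforce
  have "continuous_on {0..} (\<lambda>r. (1 / sqrt (1 + r * e)) *\<^sub>R (X + r *\<^sub>R N))"
    by (intro continuous_intros ballI ne)
  then show "connected R"
    unfolding R by (rule connected_continuous_image) (rule connected_Ici)
  show "\<not> bounded R"
  proof
    assume "bounded R"
    then obtain K where K: "\<And>Y. Y \<in> R \<Longrightarrow> norm Y \<le> K" by (auto simp: bounded_iff)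
    have "N \<noteq> 0" using N by (auto simp: trace_cmat)
    then have n: "norm N > 0" by simp
    define b where "b = norm N / e"
    \<comment> \<open>Here u is the value of the normalising root sqrt(1 + r e) at the chosen r. It
      is picked so that b (u - 1) = |K| + |X| + 1, which makes r |N| - |X| exceed K u and
      contradicts the bound K.\<close>
    define u where "u = 1 + (\<bar>K\<bar> + norm X + 1) / b"
    define r where "r = (u\<^sup>2 - 1) / e"
    have b: "b > 0" using n e by (simp add: b_def)
    have u: "u \<ge> 1" using b by (simp add: u_def)
    have r: "r \<ge> 0" "1 + r * e = u\<^sup>2" using u e by (auto simp: r_def)
    have "r * norm N = b * (u - 1) * (u + 1)" by (simp add: r_def b_def power2_eq_square algebra_simps)
    also have "b * (u - 1) = \<bar>K\<bar> + norm X + 1" using b by (simp add: u_def)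
    finally have "r * norm N - norm X = \<bar>K\<bar> * u + \<bar>K\<bar> + norm X * u + u + 1" by (simp add: algebra_simps)
    also have "\<dots> > K * u" using u
      mult_right_mono[OF abs_ge_self, of u K] mult_nonneg_nonneg[OF norm_ge_zero, of u X] by linarith
    finally have r2: "K < (r * norm N - norm X) / sqrt (1 + r * e)" using u unfolding r by (simp add: field_simps)
    have "r * norm N \<le> norm (X + r *\<^sub>R N) + norm X"
      using norm_triangle_ineq4[of "X + r *\<^sub>R N" X] r(1) by simp
    then have "(r * norm N - norm X) / sqrt (1 + r * e) \<le> norm (X + r *\<^sub>R N) / sqrt (1 + r * e)"
      using pos[OF r(1)] by (intro divide_right_mono) auto
    also have "\<dots> = norm ((1 / sqrt (1 + r * e)) *\<^sub>R (X + r *\<^sub>R N))"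
      using pos[OF r(1)] by simp
    also have "\<dots> \<le> K" using r(1) by (intro K) (auto simp: R)
    finally show False using r2 by simp
  qed
qed

section \<open>Horizontal lines in a trapezoid\<close>

definition strict_between :: "real \<Rightarrow> real \<Rightarrow> real \<Rightarrow> bool" where
  "strict_between w a b \<longleftrightarrow> min a b < w \<and> w < max a b"

lemma strict_between_commute: "strict_between w a b \<longleftrightarrow> strict_between w b a"
  by (simp add: strict_between_def min.commute max.commute)

text \<open>The parameter t at which the affine interpolation from a to b takes the value w.\<close>

definition level :: "real \<Rightarrow> real \<Rightarrow> real \<Rightarrow> real" where
  "level w a b = (w - a) / (b - a)"

lemma level_bounds:
  assumes "a < w" "w < b" shows "0 < level w a b" "level w a b < 1"
  using assms by (simp_all add: level_def)

lemma level_bounds':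
  assumes "a < w" "w < b" shows "0 < level w b a" "level w b a < 1"
  using assms by (simp_all add: level_def divide_neg_neg neg_divide_less_eq)

lemma level_eq: "a \<noteq> b \<Longrightarrow> (1 - level w a b) * a + level w a b * b = w"
proof -
  assume "a \<noteq> b"
  then have "level w a b * (b - a) = w - a" by (simp add: level_def)
  then show ?thesis by (simp add: algebra_simps)
qed

lemma level_le_iff:
  "a < b \<Longrightarrow> (1 - t) * a + t * b \<le> w \<longleftrightarrow> t \<le> level w a b"
  "a < b \<Longrightarrow> (1 - t) * b + t * a \<le> w \<longleftrightarrow> level w b a \<le> t"
  "a < b \<Longrightarrow> w \<le> (1 - t) * a + t * b \<longleftrightarrow> level w a b \<le> t"
  "a < b \<Longrightarrow> w \<le> (1 - t) * b + t * a \<longleftrightarrow> t \<le> level w b a"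
  by (auto simp: level_def pos_le_divide_eq pos_divide_le_eq neg_le_divide_eq neg_divide_le_eq algebra_simps)

text \<open>The values of t at which the line of height w crosses the sides of the trapezoid with
  corners (a0, 0), (a1, 1), (b1, 1), (b0, 0), written as (height, t): first the two parallel sides,
  then the two others.\<close>

definition cut_params :: "real \<Rightarrow> real \<Rightarrow> real \<Rightarrow> real \<Rightarrow> real \<Rightarrow> real set" where
  "cut_params w a0 a1 b0 b1 =
     {t. t = 0 \<and> strict_between w a0 b0 \<or> t = 1 \<and> strict_between w a1 b1 \<or>
         t = level w a0 a1 \<and> strict_between w a0 a1 \<or> t = level w b0 b1 \<and> strict_between w b0 b1}"

lemma cut_params_commute: "cut_params w a0 a1 b0 b1 = cut_params w b0 b1 a0 a1"
  by (auto simp: cut_params_def strict_between_commute)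

text \<open>Both inequalities are affine in t, so \<open>J\<close> is an interval that ends at 0, at
  1, or where the line crosses a non-parallel side. A line that avoids the corners cannot touch the
  trapezoid in a single point, hence the two ends differ.\<close>

lemma trapezoid_cut:
  fixes w :: real
  assumes ab: "a0 < b0" "a1 < b1" and w: "w \<noteq> a0" "w \<noteq> a1" "w \<noteq> b0" "w \<noteq> b1"
  defines "J \<equiv> {t \<in> {0..1}. (1 - t) * a0 + t * a1 \<le> w \<and> w \<le> (1 - t) * b0 + t * b1}"
  shows "J = {} \<and> cut_params w a0 a1 b0 b1 = {} \<or>
    (\<exists>t1 t2. 0 \<le> t1 \<and> t1 < t2 \<and> t2 \<le> 1 \<and> J = {t1..t2} \<and> cut_params w a0 a1 b0 b1 = {t1, t2})"
proof -
  let ?a = "level w a0 a1" and ?b = "level w b0 b1"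
  have a1: "(1 - t) * a0 + t * a1 \<le> w \<longleftrightarrow> t \<le> ?a" "0 < ?a" "?a < 1" if "a0 < w" "w < a1" for t
    using that level_le_iff(1)[of a0 a1] level_bounds[of a0 w a1] by simp_all
  have a2: "(1 - t) * a0 + t * a1 \<le> w \<longleftrightarrow> ?a \<le> t" "0 < ?a" "?a < 1" if "a1 < w" "w < a0" for t
    using that level_le_iff(2)[of a1 a0] level_bounds'[of a1 w a0] by simp_all
  have a3: "(1 - t) * a0 + t * a1 \<le> w" if "a1 < w" "a0 < w" "0 \<le> t" "t \<le> 1" for t
    using convex_bound_le[of a0 w a1 "1 - t" t] that by simp
  have a4: "\<not> (1 - t) * a0 + t * a1 \<le> w" if "w < a1" "w < a0" "0 \<le> t" "t \<le> 1" for t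
    using convex_bound_lt[of "- a0" "- w" "- a1" "1 - t" t] that by simp
  have b1: "w \<le> (1 - t) * b0 + t * b1 \<longleftrightarrow> ?b \<le> t" "0 < ?b" "?b < 1" if "b0 < w" "w < b1" for t
    using that level_le_iff(3)[of b0 b1] level_bounds[of b0 w b1] by simp_all
  have b2: "w \<le> (1 - t) * b0 + t * b1 \<longleftrightarrow> t \<le> ?b" "0 < ?b" "?b < 1" if "b1 < w" "w < b0" for t
    using that level_le_iff(4)[of b1 b0] level_bounds'[of b1 w b0] by simp_all
  have b3: "w \<le> (1 - t) * b0 + t * b1" if "w < b1" "w < b0" "0 \<le> t" "t \<le> 1" for t
    using convex_bound_le[of "- b0" "- w" "- b1" "1 - t" t] that by simp
  have b4: "\<not> w \<le> (1 - t) * b0 + t * b1" if "b1 < w" "b0 < w" "0 \<le> t" "t \<le> 1" for t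
    using convex_bound_lt[of b0 w b1 "1 - t" t] that by simp
  have fin: ?thesis if "0 \<le> t1" "t1 < t2" "t2 \<le> 1" "J = {t1..t2}" "cut_params w a0 a1 b0 b1 = {t1, t2}" for t1 t2
    using that by blast
  have pos0: "w < a0 \<or> a0 < w \<and> w < b0 \<or> b0 < w" using w by auto
  have pos1: "w < a1 \<or> a1 < w \<and> w < b1 \<or> b1 < w" using w by auto
  \<comment> \<open>On each parallel side w lies below, inside or above it, which gives nine cases;
    6 and 7 miss the trapezoid, 8 and 9 cross both non-parallel sides.\<close>
  consider (1) "a0 < w" "w < b0" "a1 < w" "w < b1" | (2) "w < a0" "a1 < w" "w < b1"
    | (3) "b0 < w" "a1 < w" "w < b1" | (4) "a0 < w" "w < b0" "w < a1"
    | (5) "a0 < w" "w < b0" "b1 < w" | (6) "w < a0" "w < a1" | (7) "b0 < w" "b1 < w"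
    | (8) "w < a0" "b1 < w" | (9) "b0 < w" "w < a1"
    using pos0 pos1 by blast
  then show ?thesis
  proof cases
    case 1
    then have "J = {0..1}" using a3 b3 by (auto simp: J_def)
    moreover have "cut_params w a0 a1 b0 b1 = {0, 1}" using 1 ab by (auto simp: cut_params_def strict_between_def)
    ultimately show ?thesis by (intro fin[of "0" "1"]) simp_all
  next
    case 2
    then have "J = {?a..1}" using a2 b3 ab by (auto simp: J_def)
    moreover have "cut_params w a0 a1 b0 b1 = {?a, 1}" using 2 ab by (auto simp: cut_params_def strict_between_def)
    ultimately show ?thesis using a2[OF 2(2,1)] by (intro fin[of "?a" "1"]) simp_all
  next
    case 3
    then have "J = {?b..1}" using b1 a3 ab by (auto simp: J_def)
    moreover have "cut_params w a0 a1 b0 b1 = {?b, 1}" using 3 ab by (auto simp: cut_params_def strict_between_def)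
    ultimately show ?thesis using b1[OF 3(1,3)] by (intro fin[of "?b" "1"]) simp_all
  next
    case 4
    then have "J = {0..?a}" using a1 b3 ab by (auto simp: J_def)
    moreover have "cut_params w a0 a1 b0 b1 = {0, ?a}" using 4 ab by (auto simp: cut_params_def strict_between_def)
    ultimately show ?thesis using a1[OF 4(1,3)] by (intro fin[of "0" "?a"]) simp_all
  next
    case 5
    then have "J = {0..?b}" using b2 a3 ab by (auto simp: J_def)
    moreover have "cut_params w a0 a1 b0 b1 = {0, ?b}" using 5 ab by (auto simp: cut_params_def strict_between_def)
    ultimately show ?thesis using b2[OF 5(3,2)] by (intro fin[of "0" "?b"]) simp_all
  next
    case 6
    then have "J = {}" using a4 by (auto simp: J_def)
    moreover have "cut_params w a0 a1 b0 b1 = {}" using 6 ab by (auto simp: cut_params_def strict_between_def)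
    ultimately show ?thesis by simp
  next
    case 7
    then have "J = {}" using b4 by (auto simp: J_def)
    moreover have "cut_params w a0 a1 b0 b1 = {}" using 7 ab by (auto simp: cut_params_def strict_between_def)
    ultimately show ?thesis by simp
  next
    case 8
    then have *: "a1 < w" "w < b0" using ab by auto
    then have "J = {?a..?b}"
      using a2[OF *(1) 8(1)] b2[OF 8(2) *(2)] unfolding J_def by (auto intro: order_trans)
    moreover have "cut_params w a0 a1 b0 b1 = {?a, ?b}" using 8 ab by (auto simp: cut_params_def strict_between_def)
    moreover have "?a < ?b"
    proof -
      have a: "(1 - ?a) * a0 + ?a * a1 = w" using * 8 by (intro level_eq) simp
      \<comment> \<open>Where the line crosses the lower side it is still strictly below the upper
        one, so the crossing with the upper side comes later. Case 9 is the mirror image.\<close>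
      have "(1 - ?a) * a0 + ?a * a1 < (1 - ?a) * b0 + ?a * b1"
        using a2(2,3)[OF *(1) 8(1)] ab by (intro add_strict_mono mult_strict_left_mono) simp_all
      then have lt: "w < (1 - ?a) * b0 + ?a * b1" unfolding a .
      have b: "(1 - ?b) * b0 + ?b * b1 = w" using * 8 by (intro level_eq) simp
      have "?a \<noteq> ?b" using lt b by (metis less_irrefl)
      moreover have "?a \<le> ?b" using iffD1[OF b2(1)[OF 8(2) *(2)] less_imp_le[OF lt]] .
      ultimately show ?thesis by simp
    qed
    ultimately show ?thesis using a2[OF *(1) 8(1)] b2[OF 8(2) *(2)] by (intro fin[of "?a" "?b"]) simp_all
  next
    case 9
    then have *: "a0 < w" "w < b1" using ab by auto
    then have "J = {?b..?a}"
      using a1[OF *(1) 9(2)] b1[OF 9(1) *(2)] unfolding J_def by auto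
    moreover have "cut_params w a0 a1 b0 b1 = {?b, ?a}" using 9 ab by (auto simp: cut_params_def strict_between_def)
    moreover have "?b < ?a"
    proof -
      have a: "(1 - ?a) * a0 + ?a * a1 = w" using * 9 by (intro level_eq) simp
      have "(1 - ?a) * a0 + ?a * a1 < (1 - ?a) * b0 + ?a * b1"
        using a1(2,3)[OF *(1) 9(2)] ab by (intro add_strict_mono mult_strict_left_mono) simp_all
      then have lt: "w < (1 - ?a) * b0 + ?a * b1" unfolding a .
      have b: "(1 - ?b) * b0 + ?b * b1 = w" using * 9 by (intro level_eq) simp
      have "?a \<noteq> ?b" using lt b by (metis less_irrefl)
      moreover have "?b \<le> ?a" using iffD1[OF b1(1)[OF 9(1) *(2)] less_imp_le[OF lt]] .
      ultimately show ?thesis by simp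
    qed
    ultimately show ?thesis using a1[OF *(1) 9(2)] b1[OF 9(1) *(2)] by (intro fin[of "?b" "?a"]) simp_all
  qed
qed

section \<open>The strip between two normal geodesics\<close>

text \<open>The data of two coplanar normal geodesics, freed from frames: B and B' are the
  light-like vectors f - N (halved) at the two ends, and U + c B and U + c B', which are light-like
  by the formula for \<open>det\<close>, are the corresponding f + N.\<close>

locale normal_strip =
  fixes U B B' :: cmat and c k :: real
  assumes herm: "herm U = U" "herm B = B" "herm B' = B'"
    and det: "det (x *\<^sub>R U + y *\<^sub>R B + z *\<^sub>R B') = of_real (x * (y + z) - c * x\<^sup>2 + k * y * z)"
    and pos: "0 < c" "0 < k"
    and trace_B: "0 < Re (trace B)" "0 < Re (trace B')"
    and trace_U: "0 < Re (trace (U + c *\<^sub>R B))" "0 < Re (trace (U + c *\<^sub>R B'))"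
begin

definition comb :: "real \<times> real \<times> real \<Rightarrow> cmat" where
  "comb v = fst v *\<^sub>R U + fst (snd v) *\<^sub>R B + snd (snd v) *\<^sub>R B'"

text \<open>An affine chart, since the weights of B and B' add up to one. For t = 0 and 0 < w < 1/c
  the point runs over the whole normal geodesic from the ideal point B to the ideal point U + c B; t
  = 1 gives the other one.\<close>

definition pt :: "real \<Rightarrow> real \<Rightarrow> cmat" where
  "pt w t = hnorm (comb (w, 1 - t, t))"

lemma linear_comb: "linear comb"
  by (rule linearI) (simp_all add: comb_def algebra_simps)

lemma det_comb: "Re (det (comb (x, y, z))) = x * (y + z) - c * x\<^sup>2 + k * y * z"
  unfolding comb_def fst_conv snd_conv det Re_complex_of_real ..

lemma herm_comb: "herm (comb v) = comb v"
  by (simp add: comb_def herm_add herm_scaleR herm)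

text \<open>The quadratic form is nondegenerate. Adding a kernel vector does not change the
  determinant; comparing at 0 and at the three basis vectors gives linear equations that reduce to 2
  x (1 + k c) = 0.\<close>

lemma inj_comb: "inj comb"
proof (rule linear_injective_0[OF linear_comb, THEN iffD2], intro allI impI)
  fix v assume v0: "comb v = 0"
  obtain x y z where v: "v = (x, y, z)" by (cases v)
  have eq: "Re (det (comb (x + x', y + y', z + z'))) = Re (det (comb (x', y', z')))" for x' y' z'
  proof -
    have "comb (x + x', y + y', z + z') = comb v + comb (x', y', z')"
      using linear_add[OF linear_comb, of v "(x', y', z')"] by (simp add: v)
    then show ?thesis by (simp add: v0)
  qed
  note e = eq[unfolded det_comb]
  have 0: "x * (y + z) - c * x\<^sup>2 + k * y * z = 0" using e[of 0 0 0] by simp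
  have "(x + 1) * (y + z) - c * (x + 1)\<^sup>2 + k * y * z = - c" using e[of 1 0 0] by simp
  with 0 have 1: "y + z = 2 * c * x" by (simp add: power2_eq_square algebra_simps)
  have "x * (y + 1 + z) - c * x\<^sup>2 + k * (y + 1) * z = 0" using e[of 0 1 0] by simp
  with 0 have 2: "x + k * z = 0" by (simp add: algebra_simps)
  have "x * (y + (z + 1)) - c * x\<^sup>2 + k * y * (z + 1) = 0" using e[of 0 0 1] by simp
  with 0 have 3: "x + k * y = 0" by (simp add: algebra_simps)
  have "2 * x + k * (y + z) = 0" using 2 3 by (simp add: algebra_simps)
  then have "2 * x * (1 + k * c) = 0" by (simp add: 1 algebra_simps)
  moreover have "1 + k * c > 0" using pos by (simp add: add_pos_pos)
  ultimately have "x = 0" by simp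
  with 2 3 pos show "v = 0" by (simp add: v zero_prod_def)
qed

text \<open>With s = y + z the determinant is x (s - c x) + k y z. For the trace, x U + s B = x (U +
  c B) + (s - c x) B is a positive combination of vectors of positive trace, and likewise for
  B'.\<close>

lemma future_comb:
  assumes "0 < x" "c * x < y + z" "0 \<le> y" "0 \<le> z"
  shows "future (comb (x, y, z))"
proof -
  define s where "s = y + z"
  have "0 < c * x" using assms pos by simp
  then have s: "s > 0" "c * x < s" unfolding s_def using assms(2) by linarith+
  have "x * s - c * x\<^sup>2 = x * (s - c * x)" by (simp add: power2_eq_square algebra_simps)
  then have d: "0 < Re (det (comb (x, y, z)))"
    unfolding det_comb s_def[symmetric] using s assms(1,3,4) pos by (simp add: add_pos_nonneg)
  have tr: "0 < x * a + s * b" if "b > 0" "0 < a + c * b" for a b :: real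
  proof -
    have "0 < x * (a + c * b) + (s - c * x) * b" using that s assms by (simp add: add_pos_pos)
    then show ?thesis by (simp add: algebra_simps)
  qed
  let ?u = "Re (trace U)" and ?b = "Re (trace B)" and ?b' = "Re (trace B')"
  have 1: "0 < x * ?u + s * ?b"
    using tr[of ?b ?u] trace_B trace_U by (simp add: trace_add_cmat trace_scaleR_cmat)
  have 2: "0 < x * ?u + s * ?b'"
    using tr[of ?b' ?u] trace_B trace_U by (simp add: trace_add_cmat trace_scaleR_cmat)
  \<comment> \<open>The factor s allows x U to be shared between B and B' in the ratio y :
    z.\<close>
  have "s * Re (trace (comb (x, y, z))) = s * (x * ?u + y * ?b + z * ?b')"
    by (simp add: comb_def trace_add_cmat trace_scaleR_cmat)
  also have "\<dots> = y * (x * ?u + s * ?b) + z * (x * ?u + s * ?b')"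
    by (simp add: s_def algebra_simps)
  also have "\<dots> > 0"
  proof -
    have "0 < y \<or> 0 < z" using s(1) assms(3,4) unfolding s_def by linarith
    then show ?thesis
      using mult_pos_pos[OF _ 1, of y] mult_pos_pos[OF _ 2, of z] assms(3,4)
        mult_nonneg_nonneg[OF assms(3) less_imp_le[OF 1]] mult_nonneg_nonneg[OF assms(4) less_imp_le[OF 2]]
      by (elim disjE) linarith+
  qed
  finally have "0 < Re (trace (comb (x, y, z)))" using s(1) by (simp add: zero_less_mult_iff)
  then show ?thesis using d by (simp add: future_def herm_comb)
qed

lemma future_pt:
  assumes "0 < w" "c * w < 1" "0 \<le> t" "t \<le> 1"
  shows "future (comb (w, 1 - t, t))"
  using future_comb[of w "1 - t" t] assms by simp

lemma pt_eq_comb: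
  assumes "0 < w" "c * w < 1" "0 \<le> t" "t \<le> 1"
  obtains r where "r > 0" "pt w t = comb (r * w, r * (1 - t), r * t)" "pt w t \<in> H3"
proof -
  obtain r where r: "r > 0" "pt w t = r *\<^sub>R comb (w, 1 - t, t)"
    using hnorm_eq_scaleR[OF future_pt[OF assms]] unfolding pt_def by blast
  have "r *\<^sub>R comb (w, 1 - t, t) = comb (r * w, r * (1 - t), r * t)"
    using linear_scale[OF linear_comb, of r "(w, 1 - t, t)"] by simp
  with r show ?thesis
    using that hnorm_H3[OF future_pt[OF assms]] unfolding pt_def by simp
qed

lemma pt_scale:
  assumes "r > 0" "comb (r * w, r * (1 - t), r * t) \<in> H3"
  shows "comb (r * w, r * (1 - t), r * t) = pt w t"
proof -
  have "comb (r * w, r * (1 - t), r * t) = r *\<^sub>R comb (w, 1 - t, t)"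
    using linear_scale[OF linear_comb, of r "(w, 1 - t, t)"] by simp
  then show ?thesis using hnorm_id[OF assms(2)] hnorm_scaleR[OF assms(1)] unfolding pt_def by metis
qed

lemma pt_inject:
  assumes "0 < w" "c * w < 1" "0 \<le> t" "t \<le> 1" "0 < w'" "c * w' < 1" "0 \<le> t'" "t' \<le> 1"
    and "pt w t = pt w' t'"
  shows "w = w'" "t = t'"
proof -
  obtain r where r: "r > 0" "pt w t = comb (r * w, r * (1 - t), r * t)"
    using pt_eq_comb[OF assms(1-4)] by metis
  obtain r' where r': "r' > 0" "pt w' t' = comb (r' * w', r' * (1 - t'), r' * t')"
    using pt_eq_comb[OF assms(5-8)] by metis
  have "(r * w, r * (1 - t), r * t) = (r' * w', r' * (1 - t'), r' * t')"
    using inj_comb r r' assms(9) by (simp add: inj_eq)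
  then have e: "r * w = r' * w'" "r * (1 - t) = r' * (1 - t')" "r * t = r' * t'" by auto
  then have "r = r'" by (simp add: algebra_simps)
  with e r show "w = w'" "t = t'" by auto
qed

lemma convex_bounds:
  assumes "0 < a" "c * a < 1" "0 < b" "c * b < 1" "0 \<le> r" "r \<le> 1"
  shows "0 < (1 - r) * a + r * b" "c * ((1 - r) * a + r * b) < 1"
proof -
  show "0 < (1 - r) * a + r * b"
    using convex_bound_lt[of "- a" 0 "- b" "1 - r" r] assms by simp
  have "(1 - r) * (c * a) + r * (c * b) < 1"
    using convex_bound_lt[of "c * a" 1 "c * b" "1 - r" r] assms by simp
  then show "c * ((1 - r) * a + r * b) < 1" by (simp add: algebra_simps)
qed

text \<open>The normalisation of the weights survives convex combinations, so geodesic segments are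
  straight segments of the (w, t) strip.\<close>

lemma geod_seg_pt:
  assumes "0 < a" "c * a < 1" "0 \<le> s" "s \<le> 1" "0 < b" "c * b < 1" "0 \<le> t" "t \<le> 1"
  shows "geod_seg (pt a s) (pt b t) = (\<lambda>r. pt ((1 - r) * a + r * b) ((1 - r) * s + r * t)) ` {0..1}"
proof -
  have comb: "(1 - r) *\<^sub>R comb (a, 1 - s, s) + r *\<^sub>R comb (b, 1 - t, t) =
      comb ((1 - r) * a + r * b, 1 - ((1 - r) * s + r * t), (1 - r) * s + r * t)" for r
    by (simp add: comb_def algebra_simps)
  have st: "0 \<le> (1 - r) * s + r * t" "(1 - r) * s + r * t \<le> 1" if "r \<in> {0..1}" for r
    using that assms convex_bound_le[of s 1 t "1 - r" r] by auto
  have "geod_seg (pt a s) (pt b t) = (\<lambda>r. hnorm ((1 - r) *\<^sub>R comb (a, 1 - s, s) + r *\<^sub>R comb (b, 1 - t, t))) ` {0..1}"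
    unfolding pt_def
  proof (rule geod_seg_hnorm)
    fix r :: real assume "r \<in> {0..1}"
    then show "future ((1 - r) *\<^sub>R comb (a, 1 - s, s) + r *\<^sub>R comb (b, 1 - t, t))"
      unfolding comb using assms st by (intro future_pt convex_bounds) auto
  qed
  then show ?thesis unfolding comb pt_def by simp
qed

lemma geod_seg_level:
  assumes w: "0 < w" "c * w < 1" and t: "0 \<le> s" "s < t" "t \<le> 1"
  shows "geod_seg (pt w s) (pt w t) = pt w ` {s..t}"
proof -
  have "geod_seg (pt w s) (pt w t) = pt w ` (\<lambda>r. (1 - r) * s + r * t) ` {0..1}"
    using t w by (subst geod_seg_pt) (auto simp: image_image algebra_simps)
  also have "(\<lambda>r. (1 - r) * s + r * t) ` {0..1} = {s..t}"
    using t closed_segment_real_eq[of s t] by (simp add: closed_segment_eq_real_ivl closed_segment_def algebra_simps image_def)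
  finally show ?thesis .
qed

text \<open>Identifies the enclosed region, given by bounded components, with the trapezoid in the
  chart. From a point of the strip below or above it a light-like ray escapes to infinity without
  meeting the polygon; a point inside has its component confined to a bounded set by the signs of
  four linear forms.\<close>

lemma trapezoid_region:
  assumes a: "0 < a0" "c * a0 < 1" "0 < a1" "c * a1 < 1"
    and b: "0 < b0" "c * b0 < 1" "0 < b1" "c * b1 < 1"
    and ab: "a0 < b0" "a1 < b1"
    and w: "0 < w" "c * w < 1" and t: "0 \<le> t" "t \<le> 1"
  shows "pt w t \<in> geod_quad_region (pt a0 0) (pt a1 1) (pt b1 1) (pt b0 0) \<longleftrightarrow>
    (1 - t) * a0 + t * a1 \<le> w \<and> w \<le> (1 - t) * b0 + t * b1"
proof -
  define Q where "Q = geod_quad (pt a0 0) (pt a1 1) (pt b1 1) (pt b0 0)"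
  define plane where "plane = span {pt a0 0, pt a1 1, pt b1 1, pt b0 0} \<inter> H3"
  define lo where "lo t = (1 - t) * a0 + t * a1" for t
  define hi where "hi t = (1 - t) * b0 + t * b1" for t
  have lohi: "0 < lo t" "c * lo t < 1" "0 < hi t" "c * hi t < 1" "lo t < hi t" if "0 \<le> t" "t \<le> 1" for t
  proof -
    show "0 < lo t" "c * lo t < 1" "0 < hi t" "c * hi t < 1"
      using convex_bounds[of a0 a1 t] convex_bounds[of b0 b1 t] a b that by (simp_all add: lo_def hi_def)
    have "(1 - t) * (a0 - b0) + t * (a1 - b1) < 0"
      using convex_bound_lt[of "a0 - b0" 0 "a1 - b1" "1 - t" t] that ab by simp
    then show "lo t < hi t" by (simp add: lo_def hi_def algebra_simps)
  qed
  have reg: "geod_quad_region (pt a0 0) (pt a1 1) (pt b1 1) (pt b0 0) =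
      Q \<union> {X \<in> plane - Q. bounded (connected_component_set (plane - Q) X)}"
    by (simp add: geod_quad_region_def Q_def plane_def Let_def)
  have seg_lo: "geod_seg (pt a0 0) (pt a1 1) = (\<lambda>t. pt (lo t) t) ` {0..1}"
    using a by (subst geod_seg_pt) (auto simp: lo_def)
  have seg_hi: "geod_seg (pt b1 1) (pt b0 0) = (\<lambda>t. pt (hi t) t) ` {0..1}"
    unfolding geod_seg_commute[of "pt b1 1"] using b by (subst geod_seg_pt) (auto simp: hi_def)
  have vert: "geod_seg (pt x t) (pt y t) = (\<lambda>w. pt w t) ` {x..y}"
    if "0 < x" "x < y" "c * y < 1" "t \<in> {0..1}" for x y t
  proof -
    have "c * x < c * y" using that pos by simp
    then have "c * x < 1" using that by simp
    then have "geod_seg (pt x t) (pt y t) = (\<lambda>w. pt w t) ` (\<lambda>r. (1 - r) * x + r * y) ` {0..1}"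
      using that by (subst geod_seg_pt) (auto simp: image_image algebra_simps)
    also have "(\<lambda>r. (1 - r) * x + r * y) ` {0..1} = {x..y}"
      using that closed_segment_real_eq[of x y] by (simp add: closed_segment_eq_real_ivl closed_segment_def algebra_simps image_def)
    finally show ?thesis .
  qed
  have seg_1: "geod_seg (pt a1 1) (pt b1 1) = (\<lambda>w. pt w 1) ` {a1..b1}"
    using a b ab by (intro vert) auto
  have seg_0: "geod_seg (pt b0 0) (pt a0 0) = (\<lambda>w. pt w 0) ` {a0..b0}"
    unfolding geod_seg_commute[of "pt b0 0"] using a b ab by (intro vert) auto
  have Q_iff: "X \<in> Q \<longleftrightarrow> (\<exists>w t. X = pt w t \<and> 0 \<le> t \<and> t \<le> 1 \<and> lo t \<le> w \<and> w \<le> hi t \<and>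
      (t = 0 \<or> t = 1 \<or> w = lo t \<or> w = hi t))" (is "_ \<longleftrightarrow> ?R") for X
  proof
    assume "X \<in> Q"
    then consider t where "X = pt (lo t) t" "0 \<le> t" "t \<le> 1" | t where "X = pt (hi t) t" "0 \<le> t" "t \<le> 1"
      | w where "X = pt w 1" "a1 \<le> w" "w \<le> b1" | w where "X = pt w 0" "a0 \<le> w" "w \<le> b0"
      unfolding Q_def geod_quad_def seg_lo seg_hi seg_0 seg_1 by auto
    then show ?R
    proof cases
      case (1 t) then show ?thesis using lohi(5)[of t] by (intro exI[of _ "lo t"] exI[of _ t]) auto
    next
      case (2 t) then show ?thesis using lohi(5)[of t] by (intro exI[of _ "hi t"] exI[of _ t]) auto
    next
      case (3 w) then show ?thesis by (intro exI[of _ w] exI[of _ 1]) (auto simp: lo_def hi_def)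
    next
      case (4 w) then show ?thesis by (intro exI[of _ w] exI[of _ 0]) (auto simp: lo_def hi_def)
    qed
  next
    assume ?R
    then obtain w t where wt: "X = pt w t" "0 \<le> t" "t \<le> 1" "lo t \<le> w" "w \<le> hi t"
      "t = 0 \<or> t = 1 \<or> w = lo t \<or> w = hi t" by blast
    have 0: "lo 0 = a0" "hi 0 = b0" "lo 1 = a1" "hi 1 = b1" by (auto simp: lo_def hi_def)
    from wt(6) show "X \<in> Q"
    proof (elim disjE)
      assume "t = 0" then show ?thesis using wt 0 unfolding Q_def geod_quad_def seg_0 by auto
    next
      assume "t = 1" then show ?thesis using wt 0 unfolding Q_def geod_quad_def seg_1 by auto
    next
      assume "w = lo t" then show ?thesis using wt unfolding Q_def geod_quad_def seg_lo by auto
    next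
      assume "w = hi t" then show ?thesis using wt unfolding Q_def geod_quad_def seg_hi by auto
    qed
  qed
  have span_sub: "span {pt a0 0, pt a1 1, pt b1 1, pt b0 0} \<subseteq> range comb"
  proof (rule span_minimal)
    have "pt w t \<in> range comb" if "0 < w" "c * w < 1" "0 \<le> t" "t \<le> 1" for w t
      using pt_eq_comb[OF that] by (metis rangeI)
    then show "{pt a0 0, pt a1 1, pt b1 1, pt b0 0} \<subseteq> range comb" using a b by auto
    show "subspace (range comb)" using linear_subspace_image[OF linear_comb subspace_UNIV] .
  qed
  define L where "L = span {pt a0 0, pt a1 1, pt b1 1, pt b0 0}"
  have L: "subspace L" unfolding L_def by (rule subspace_span)
  have base: "pt a0 0 \<in> L" "pt a1 1 \<in> L" "pt b0 0 \<in> L" unfolding L_def by (intro span_base; simp)+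
  have in_L: "w *\<^sub>R U + (1 - t) *\<^sub>R B + t *\<^sub>R B' \<in> L"
    if "pt w t \<in> L" "0 < w" "c * w < 1" "0 \<le> t" "t \<le> 1" for w t
  proof -
    obtain r where r: "r > 0" "hnorm (comb (w, 1 - t, t)) = r *\<^sub>R comb (w, 1 - t, t)"
      by (rule hnorm_eq_scaleR[OF future_pt[OF \<open>0 < w\<close> \<open>c * w < 1\<close> \<open>0 \<le> t\<close> \<open>t \<le> 1\<close>]])
    have "(1 / r) *\<^sub>R pt w t \<in> L" using that(1) by (rule subspace_scale[OF L])
    also have "(1 / r) *\<^sub>R pt w t = comb (w, 1 - t, t)" unfolding pt_def r(2) using r(1) by simp
    finally show ?thesis by (simp only: comb_def fst_conv snd_conv)
  qed
  have 1: "a0 *\<^sub>R U + B \<in> L" using in_L[of a0 0] base(1) a by simp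
  have 2: "b0 *\<^sub>R U + B \<in> L" using in_L[of b0 0] base(3) b by simp
  have 3: "a1 *\<^sub>R U + B' \<in> L" using in_L[of a1 1] base(2) a by simp
  \<comment> \<open>The two corners on t = 0 have representatives that differ by a nonzero multiple
    of U. Once U lies in the span, so do B and B', and the plane of the face is all of
    \<open>range comb\<close>.\<close>
  have "(1 / (b0 - a0)) *\<^sub>R ((b0 *\<^sub>R U + B) - (a0 *\<^sub>R U + B)) \<in> L"
    by (intro subspace_scale[OF L] subspace_diff[OF L] 1 2)
  also have "(1 / (b0 - a0)) *\<^sub>R ((b0 *\<^sub>R U + B) - (a0 *\<^sub>R U + B)) = U"
    using ab by (simp flip: scaleR_diff_left)
  finally have U: "U \<in> L" .
  have "(a0 *\<^sub>R U + B) - a0 *\<^sub>R U \<in> L" by (intro subspace_scale[OF L] subspace_diff[OF L] 1 U)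
  then have B: "B \<in> L" by simp
  have "(a1 *\<^sub>R U + B') - a1 *\<^sub>R U \<in> L" by (intro subspace_scale[OF L] subspace_diff[OF L] 3 U)
  then have B': "B' \<in> L" by simp
  have "comb v \<in> L" for v
    unfolding comb_def by (intro subspace_add[OF L] subspace_scale[OF L] U B B')
  then have span_sup: "range comb \<subseteq> span {pt a0 0, pt a1 1, pt b1 1, pt b0 0}"
    unfolding L_def by blast
  have plane: "plane = range comb \<inter> H3" using span_sub span_sup by (auto simp: plane_def)
  \<comment> \<open>A linear left inverse is defined on all matrices and is continuous, so sign
    conditions on coordinates define open sets of matrices.\<close>
  obtain coord where coord: "linear coord" "coord \<circ> comb = id"
    using linear_injective_left_inverse[OF linear_comb inj_comb] by blast
  have coord_comb: "coord (comb v) = v" for v using coord(2) by (metis comp_apply id_apply)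
  have cont: "continuous_on UNIV coord" using coord(1) linear_continuous_on linear_conv_bounded_linear by blast
  \<comment> \<open>The homogeneous versions of w - lo t, hi t - w, 1 - t and t; at a point of the
    strip they differ from these by a common positive factor.\<close>
  define l1 where "l1 v = fst v - a0 * fst (snd v) - a1 * snd (snd v)" for v :: "real \<times> real \<times> real"
  define l2 where "l2 v = b0 * fst (snd v) + b1 * snd (snd v) - fst v" for v :: "real \<times> real \<times> real"
  define l3 where "l3 v = fst (snd v)" for v :: "real \<times> real \<times> real"
  define l4 where "l4 v = snd (snd v)" for v :: "real \<times> real \<times> real"
  note l_defs = l1_def l2_def l3_def l4_def
  \<comment> \<open>Inside and outside of the trapezoid as disjoint open sets; within the plane,
    what belongs to neither lies on the polygon \<open>Q\<close>.\<close>
  define O1 where "O1 = {X. 0 < l1 (coord X) \<and> 0 < l2 (coord X) \<and> 0 < l3 (coord X) \<and> 0 < l4 (coord X)}"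
  define O2 where "O2 = {X. l1 (coord X) < 0 \<or> l2 (coord X) < 0 \<or> l3 (coord X) < 0 \<or> l4 (coord X) < 0}"
  have "open O1" "open O2"
    unfolding O1_def O2_def l_defs
    by (intro open_Collect_conj open_Collect_disj open_Collect_less continuous_intros
        continuous_on_subset[OF cont] subset_UNIV)+
  have coord_pt: "\<exists>r>0. coord (pt w t) = (r * w, r * (1 - t), r * t)"
    if "0 < w" "c * w < 1" "0 \<le> t" "t \<le> 1" for w t
    using pt_eq_comb[OF that] by (metis coord_comb)
  have Q_sign: "0 \<le> l1 (coord X) \<and> 0 \<le> l2 (coord X) \<and> 0 \<le> l3 (coord X) \<and> 0 \<le> l4 (coord X) \<and>
       (l1 (coord X) = 0 \<or> l2 (coord X) = 0 \<or> l3 (coord X) = 0 \<or> l4 (coord X) = 0)" if X: "X \<in> Q" for X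
  proof -
    obtain w t where wt: "X = pt w t" "0 \<le> t" "t \<le> 1" "lo t \<le> w" "w \<le> hi t"
      "t = 0 \<or> t = 1 \<or> w = lo t \<or> w = hi t" using X Q_iff by blast
    have "c * w \<le> c * hi t" using wt pos by simp
    then have "0 < w" "c * w < 1" using lohi[OF wt(2,3)] wt(4) by linarith+
    then obtain r where r: "r > 0" "coord X = (r * w, r * (1 - t), r * t)" using coord_pt wt by blast
    have l: "l1 (coord X) = r * (w - lo t)" "l2 (coord X) = r * (hi t - w)"
      "l3 (coord X) = r * (1 - t)" "l4 (coord X) = r * t"
      by (simp_all add: r l_defs lo_def hi_def algebra_simps)
    show ?thesis unfolding l using r(1) wt by auto
  qed
  have Q_conv: "X \<in> Q" if X: "X \<in> plane" "0 \<le> l1 (coord X)" "0 \<le> l2 (coord X)" "0 \<le> l3 (coord X)" "0 \<le> l4 (coord X)"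
       "l1 (coord X) = 0 \<or> l2 (coord X) = 0 \<or> l3 (coord X) = 0 \<or> l4 (coord X) = 0" for X
  proof -
    obtain x y z where xyz: "X = comb (x, y, z)" using X(1) plane by auto
    have l: "l1 (coord X) = x - a0 * y - a1 * z" "l2 (coord X) = b0 * y + b1 * z - x" "l3 (coord X) = y" "l4 (coord X) = z"
      by (simp_all add: xyz coord_comb l_defs)
    have xb: "0 \<le> x - a0 * y - a1 * z" "0 \<le> b0 * y + b1 * z - x" and yz: "y \<ge> 0" "z \<ge> 0"
      using X(2-5) unfolding l by blast+
    \<comment> \<open>The total weight of B and B'. If it were zero, the two inequalities
      \<open>xb\<close> would force x = 0 and thus X = 0, which is not in \<open>H3\<close>.\<close>
    define q where "q = y + z"
    have "q \<noteq> 0"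
    proof
      assume "q = 0"
      then have yz0: "y = 0" "z = 0" using yz unfolding q_def by linarith+
      then have "x = 0" using xb by simp
      with yz0 have "X = 0" by (simp add: xyz comb_def)
      then show False using X(1) by (simp add: plane_def H3_def det_2)
    qed
    then have q: "q > 0" using yz unfolding q_def by linarith
    define t where "t = z / q"
    define w where "w = x / q"
    have t: "0 \<le> t" "t \<le> 1" using yz q by (auto simp: t_def q_def)
    have "q * (1 - t) = q - z" using q by (simp add: t_def algebra_simps)
    then have eqs: "x = q * w" "y = q * (1 - t)" "z = q * t"
      using q by (simp_all add: w_def t_def) (simp add: q_def)
    have "comb (q * w, q * (1 - t), q * t) \<in> H3"
      unfolding eqs[symmetric] using X(1) unfolding xyz plane by blast
    from pt_scale[OF q this] have Xpt: "X = pt w t" unfolding eqs[symmetric] xyz .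
    have l': "x - a0 * y - a1 * z = q * (w - lo t)" "b0 * y + b1 * z - x = q * (hi t - w)"
      unfolding eqs lo_def hi_def by (simp_all add: algebra_simps)
    have "lo t \<le> w" "w \<le> hi t" using xb q unfolding l' by (simp_all add: zero_le_mult_iff)
    moreover have "t = 0 \<or> t = 1 \<or> w = lo t \<or> w = hi t"
    proof -
      have "q * (w - lo t) = 0 \<or> q * (hi t - w) = 0 \<or> q * (1 - t) = 0 \<or> q * t = 0"
        using X(6) unfolding l l' eqs(2,3)[symmetric] .
      then show ?thesis using q by auto
    qed
    ultimately show ?thesis using Q_iff[of X] Xpt t by blast
  qed
  obtain r where r: "r > 0" "pt w t = comb (r * w, r * (1 - t), r * t)" "pt w t \<in> H3"
    using pt_eq_comb[OF w t] by metis
  have ptl: "l1 (coord (pt w t)) = r * (w - lo t)" "l2 (coord (pt w t)) = r * (hi t - w)"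
      "l3 (coord (pt w t)) = r * (1 - t)" "l4 (coord (pt w t)) = r * t"
    by (simp_all add: r(2) coord_comb l_defs lo_def hi_def algebra_simps)
  have pt_plane: "pt w t \<in> plane" unfolding plane using r by auto
  \<comment> \<open>A linear form that is negative at the point and at the direction n is negative
    along the whole ray, whereas \<open>l1\<close> and \<open>l2\<close> are nonnegative on
    \<open>Q\<close>; so the ray stays in one component, which is unbounded by
    \<open>geod_ray\<close>.\<close>
  have unb: "pt w t \<notin> geod_quad_region (pt a0 0) (pt a1 1) (pt b1 1) (pt b0 0)"
    if N: "herm N = N" "0 < Re (trace N)" "e > 0" "N = comb n" and neg: "l n < 0" "l (coord (pt w t)) < 0"
      and lin: "linear l" and l: "l = l1 \<or> l = l2"
      and det: "\<And>u. u \<ge> 0 \<Longrightarrow> Re (det (pt w t + u *\<^sub>R N)) = 1 + u * e" for N e n l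
  proof -
    define R where "R = (\<lambda>u. hnorm (pt w t + u *\<^sub>R N)) ` {0..}"
    note R = geod_ray[OF r(3) N(1-3) det, folded R_def]
    have "R \<subseteq> plane - Q"
    proof
      fix X assume X: "X \<in> R"
      then obtain u where u: "u \<ge> 0" "X = hnorm (pt w t + u *\<^sub>R N)" by (auto simp: R_def)
      define v where "v = (1 / sqrt (1 + u * e)) *\<^sub>R ((r * w, r * (1 - t), r * t) + u *\<^sub>R n)"
      have X_eq: "X = comb v"
        unfolding u hnorm_def det[OF u(1)] v_def linear_scale[OF linear_comb] linear_add[OF linear_comb]
        by (simp add: r(2) N(4) linear_scale[OF linear_comb])
      have "0 < 1 + u * e" using u N(3) by (simp add: add_pos_nonneg)
      moreover have "l (r * w, r * (1 - t), r * t) + u * l n < 0"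
        using neg u(1) by (simp add: r(2) coord_comb add_neg_nonpos mult_nonneg_nonpos)
      ultimately have "l v < 0"
        unfolding v_def linear_scale[OF lin] linear_add[OF lin] by (simp add: divide_neg_pos)
      then have "X \<notin> Q" using Q_sign[of X] l by (auto simp: X_eq coord_comb)
      then show "X \<in> plane - Q" using R(1) X by (auto simp: plane X_eq)
    qed
    moreover from this have "R \<subseteq> connected_component_set (plane - Q) (pt w t)"
      using R(2,3) by (intro connected_component_maximal)
    ultimately show ?thesis unfolding reg using R(2,4) bounded_subset by blast
  qed
  have detr: "Re (det (pt w t)) = 1" using r(3) by (simp add: H3_iff)
  show ?thesis unfolding lo_def[symmetric] hi_def[symmetric]
  proof (intro iffI conjI)
    assume inside: "pt w t \<in> geod_quad_region (pt a0 0) (pt a1 1) (pt b1 1) (pt b0 0)"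
    have det_add: "Re (det (pt w t + u *\<^sub>R comb (x, y, z))) =
        (r * w + u * x) * (r * (1 - t) + u * y + (r * t + u * z)) - c * (r * w + u * x)\<^sup>2
          + k * (r * (1 - t) + u * y) * (r * t + u * z)" for u x y z
    proof -
      have "pt w t + u *\<^sub>R comb (x, y, z) = comb (r * w + u * x, r * (1 - t) + u * y, r * t + u * z)"
        by (simp add: r(2) comb_def algebra_simps)
      then show ?thesis by (simp only: det_comb)
    qed
    have det1: "r * w * r - c * (r * w)\<^sup>2 + k * (r * (1 - t)) * (r * t) = 1"
      using det_add[of 0 0 0 0] detr by (simp add: algebra_simps)
    \<comment> \<open>Below the lower side the ray heads for the ideal point B, where
      \<open>l1\<close> equals -a0.\<close>
    show "lo t \<le> w"
    proof (rule ccontr)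
      assume "\<not> lo t \<le> w"
      then have "l1 (coord (pt w t)) < 0" unfolding ptl using r(1) by (simp add: mult_pos_neg)
      moreover have "linear l1" by (rule linearI) (simp_all add: l1_def algebra_simps)
      moreover have "Re (det (pt w t + u *\<^sub>R B)) = 1 + u * (r * w + k * (r * t))" for u
        using det_add[of u 0 1 0] det1 by (simp add: comb_def algebra_simps)
      moreover have "0 < r * w + k * (r * t)" using r(1) w t pos by (simp add: add_pos_nonneg)
      ultimately show False
        using unb[of B "r * w + k * (r * t)" "(0, 1, 0)" l1] inside herm trace_B a
        by (simp add: comb_def l1_def)
    qed
    \<comment> \<open>Above the upper side the ray heads for the ideal point U + c B, where
      \<open>l2\<close> equals c b0 - 1.\<close>
    show "w \<le> hi t"
    proof (rule ccontr)
      assume "\<not> w \<le> hi t"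
      then have "l2 (coord (pt w t)) < 0" unfolding ptl using r(1) by (simp add: mult_pos_neg)
      moreover have "linear l2" by (rule linearI) (simp_all add: l2_def algebra_simps)
      moreover have "Re (det (pt w t + u *\<^sub>R comb (1, c, 0))) = 1 + u * (r - c * (r * w) + k * c * (r * t))" for u
        using det_add[of u 1 c 0] det1 by (simp add: power2_eq_square algebra_simps)
      moreover have "0 < r - c * (r * w) + k * c * (r * t)"
      proof -
        have "0 < r * (1 - c * w)" using r(1) w by simp
        moreover have "0 \<le> k * c * (r * t)" using r(1) t pos by simp
        ultimately show ?thesis by (simp add: algebra_simps)
      qed
      moreover have "l2 (1, c, 0) < 0" using b by (simp add: l2_def mult.commute)
      moreover have "0 < Re (trace (comb (1, c, 0)))" using trace_U by (simp add: comb_def)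
      ultimately show False
        using unb[of "comb (1, c, 0)" "r - c * (r * w) + k * c * (r * t)" "(1, c, 0)" l2] inside herm_comb by blast
    qed
  next
    assume tr: "lo t \<le> w \<and> w \<le> hi t"
    show "pt w t \<in> geod_quad_region (pt a0 0) (pt a1 1) (pt b1 1) (pt b0 0)"
    proof (cases "pt w t \<in> Q")
      case True then show ?thesis by (simp add: reg)
    next
      case False
      define C where "C = connected_component_set (plane - Q) (pt w t)"
      have in_C: "pt w t \<in> C" using False pt_plane by (simp add: C_def)
      have CQ: "C \<subseteq> plane - Q" by (simp add: C_def connected_component_subset)
      have off_Q: "X \<in> O1" if X: "X \<in> plane" "X \<notin> Q" "0 \<le> l1 (coord X)" "0 \<le> l2 (coord X)"
        "0 \<le> l3 (coord X)" "0 \<le> l4 (coord X)" for X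
      proof -
        have "l1 (coord X) \<noteq> 0" "l2 (coord X) \<noteq> 0" "l3 (coord X) \<noteq> 0" "l4 (coord X) \<noteq> 0"
          using Q_conv[OF X(1,3-6)] X(2) by blast+
        with X(3-6) show ?thesis unfolding O1_def by (intro CollectI conjI) linarith+
      qed
      have "pt w t \<in> O1"
        by (rule off_Q[OF pt_plane False]) (use r(1) tr t in \<open>simp_all add: ptl\<close>)
      moreover have "C \<subseteq> O1 \<union> O2"
      proof
        fix X assume "X \<in> C"
        then have X: "X \<in> plane" "X \<notin> Q" using CQ by auto
        show "X \<in> O1 \<union> O2"
        proof (cases "X \<in> O2")
          case False
          then have "0 \<le> l1 (coord X)" "0 \<le> l2 (coord X)" "0 \<le> l3 (coord X)" "0 \<le> l4 (coord X)"
            unfolding O2_def by auto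
          from off_Q[OF X this] show ?thesis ..
        qed simp
      qed
      moreover have "O1 \<inter> O2 \<inter> C = {}" by (auto simp: O1_def O2_def)
      moreover have "connected C" by (simp add: C_def)
      ultimately have "O2 \<inter> C = {}"
        using connectedD[OF _ \<open>open O1\<close> \<open>open O2\<close>, of C] in_C by blast
      with \<open>C \<subseteq> O1 \<union> O2\<close> CQ have C: "C \<subseteq> O1 \<inter> plane" by blast
      define m where "m = min a0 a1"
      define M where "M = max b0 b1"
      have m: "m > 0" "m \<le> a0" "m \<le> a1" using a by (auto simp: m_def)
      have M: "c * M < 1" "b0 \<le> M" "b1 \<le> M" using b by (auto simp: M_def max_def)
      \<comment> \<open>On \<open>O1\<close> one has m (y + z) \<le> x \<le> M (y + z). Since the
        determinant is 1, this gives m (1 - c M) (y + z)^2 \<le> 1, so S bounds y + z and thereby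
        all coordinates.\<close>
      define S where "S = sqrt (1 / (m * (1 - c * M)))"
      have S: "S \<ge> 0" using m M by (simp add: S_def)
      have M0: "M \<ge> 0" using M b by linarith
      have "norm X \<le> S * (M * norm U + norm B + norm B')" if X: "X \<in> O1 \<inter> plane" for X
      proof -
        obtain x y z where xyz: "X = comb (x, y, z)" and H: "X \<in> H3" using X plane by auto
        have yz: "y > 0" "z > 0" and x: "a0 * y + a1 * z < x" "x < b0 * y + b1 * z"
          using X by (auto simp: O1_def xyz coord_comb l_defs)
        have "m * y + m * z \<le> a0 * y + a1 * z" using m yz by (intro add_mono mult_right_mono) auto
        with x have 1: "m * (y + z) \<le> x" by (simp add: algebra_simps)
        have "b0 * y + b1 * z \<le> M * y + M * z" using M yz by (intro add_mono mult_right_mono) auto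
        with x have 2: "x \<le> M * (y + z)" by (simp add: algebra_simps)
        then have "c * x \<le> c * (M * (y + z))" using pos by simp
        then have 3: "(1 - c * M) * (y + z) \<le> y + z - c * x" by (simp add: algebra_simps)
        have x0: "0 \<le> x" using order_trans[OF mult_nonneg_nonneg 1] m yz by simp
        have "0 \<le> (1 - c * M) * (y + z)" using M yz by (intro mult_nonneg_nonneg) simp_all
        from mult_mono[OF 1 3 x0 this]
        have "m * (y + z) * ((1 - c * M) * (y + z)) \<le> x * (y + z - c * x)" .
        also have "\<dots> \<le> x * (y + z - c * x) + k * y * z" using pos yz by simp
        also have "\<dots> = x * (y + z) - c * x\<^sup>2 + k * y * z"
          by (simp add: power2_eq_square algebra_simps)
        also have "\<dots> = 1" using H det_comb[of x y z] by (simp add: H3_iff xyz)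
        finally have "(y + z)\<^sup>2 * (m * (1 - c * M)) \<le> 1" by (simp add: power2_eq_square algebra_simps)
        then have "(y + z)\<^sup>2 \<le> 1 / (m * (1 - c * M))" using m M by (simp add: pos_le_divide_eq)
        then have 4: "y + z \<le> S" unfolding S_def using real_le_rsqrt by blast
        have "norm X \<le> norm (x *\<^sub>R U) + norm (y *\<^sub>R B) + norm (z *\<^sub>R B')"
          unfolding xyz comb_def fst_conv snd_conv by (intro norm_triangle_mono order_refl)
        also have "\<dots> = x * norm U + y * norm B + z * norm B'"
          using yz x0 by simp
        also have "\<dots> \<le> (S * M) * norm U + S * norm B + S * norm B'"
        proof (intro add_mono mult_right_mono)
          show "x \<le> S * M" using 2 mult_right_mono[OF 4 M0] by (simp add: mult.commute)
        qed (use yz 4 in auto)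
        finally show ?thesis by (simp add: algebra_simps)
      qed
      then have "bounded C" using C unfolding bounded_iff by blast
      then show ?thesis using pt_plane False by (simp add: reg C_def)
    qed
  qed
qed

end

text \<open>The crossing with the side XY whose ends have normal parameters a and b. The weights are
  the barycentric ones of the chart with denominators cleared; absolute values cover both orders of
  a and b.\<close>

definition side_point :: "cmat \<Rightarrow> cmat \<Rightarrow> real \<Rightarrow> real \<Rightarrow> real \<Rightarrow> cmat" where
  "side_point X Y a b s = hnorm ((a * \<bar>b\<^sup>2 - s\<^sup>2\<bar>) *\<^sub>R X + (b * \<bar>s\<^sup>2 - a\<^sup>2\<bar>) *\<^sub>R Y)"

lemma level_weights:
  assumes "strict_between w a b"
  shows "\<bar>b - a\<bar> * level w a b = \<bar>w - a\<bar>" "\<bar>b - a\<bar> * (1 - level w a b) = \<bar>b - w\<bar>"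
proof -
  have "b - a \<noteq> 0" using assms by (auto simp: strict_between_def)
  then have eq: "(b - a) * level w a b = w - a" by (simp add: level_def)
  then have eq': "(b - a) * (1 - level w a b) = b - w" by (simp add: algebra_simps)
  have "a < w \<and> w < b \<or> b < w \<and> w < a" using assms by (auto simp: strict_between_def)
  then have "\<bar>b - a\<bar> = b - a \<and> \<bar>w - a\<bar> = w - a \<and> \<bar>b - w\<bar> = b - w \<or>
      \<bar>b - a\<bar> = - (b - a) \<and> \<bar>w - a\<bar> = - (w - a) \<and> \<bar>b - w\<bar> = - (b - w)" by auto
  then show "\<bar>b - a\<bar> * level w a b = \<bar>w - a\<bar>" "\<bar>b - a\<bar> * (1 - level w a b) = \<bar>b - w\<bar>"
    using eq eq' by (elim disjE; simp only: mult_minus_left)+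
qed

section \<open>Order of the sides of a face and the cut through it\<close>

context normal_strip
begin

text \<open>If the corners were ordered oppositely on the two normal geodesics, the remaining two
  sides, being graphs of affine functions of t, would cross, which a simple quadrilateral
  excludes.\<close>

lemma strip_dichotomy:
  assumes a: "0 < a0" "c * a0 < 1" "0 < a1" "c * a1 < 1"
    and b: "0 < b0" "c * b0 < 1" "0 < b1" "c * b1 < 1"
    and simple: "simple_quad geod_seg (pt a0 0) (pt a1 1) (pt b1 1) (pt b0 0)"
  shows "a0 < b0 \<and> a1 < b1 \<or> b0 < a0 \<and> b1 < a1"
proof -
  have ne: "a0 \<noteq> b0" "a1 \<noteq> b1" using simple by (auto simp: simple_quad_def)
  have disj: "geod_seg (pt a0 0) (pt a1 1) \<inter> geod_seg (pt b1 1) (pt b0 0) = {}"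
    using simple by (simp add: simple_quad_def)
  have "\<not> (a0 - b0) * (a1 - b1) < 0"
  proof
    assume neg: "(a0 - b0) * (a1 - b1) < 0"
    \<comment> \<open>The zero of the affine function that goes from a0 - b0 at t = 0 to a1 - b1 at
      t = 1.\<close>
    define t where "t = (a0 - b0) / ((a0 - b0) - (a1 - b1))"
    have "0 < t \<and> t < 1 \<and> t * ((a0 - b0) - (a1 - b1)) = a0 - b0"
      using neg unfolding mult_less_0_iff t_def
      by (elim disjE) (auto simp: zero_less_divide_iff divide_less_eq)
    then have t: "0 \<le> t" "t \<le> 1" and "t * ((a0 - b0) - (a1 - b1)) = a0 - b0" by auto
    then have eq: "(1 - t) * a0 + t * a1 = (1 - t) * b0 + t * b1" by (simp add: algebra_simps)
    have "pt ((1 - t) * a0 + t * a1) t \<in> geod_seg (pt a0 0) (pt a1 1)"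
      using a t by (subst geod_seg_pt) (auto intro!: image_eqI[of _ _ t])
    moreover have "pt ((1 - t) * b0 + t * b1) t \<in> geod_seg (pt b0 0) (pt b1 1)"
      using b t by (subst geod_seg_pt) (auto intro!: image_eqI[of _ _ t])
    ultimately show False using disj unfolding geod_seg_commute[of "pt b1 1"] eq by blast
  qed
  then show ?thesis using ne by (auto simp: mult_less_0_iff)
qed

lemma strip_cut_ordered:
  assumes a: "0 < a0" "c * a0 < 1" "0 < a1" "c * a1 < 1"
    and b: "0 < b0" "c * b0 < 1" "0 < b1" "c * b1 < 1"
    and w: "0 < w" "c * w < 1" "w \<noteq> a0" "w \<noteq> a1" "w \<noteq> b0" "w \<noteq> b1"
    and ab: "a0 < b0" "a1 < b1"
  defines "S \<equiv> geod_quad_region (pt a0 0) (pt a1 1) (pt b1 1) (pt b0 0) \<inter> geod_seg (pt w 0) (pt w 1)"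
    and "e \<equiv> pt w ` cut_params w a0 a1 b0 b1"
  shows "S = {} \<and> e = {} \<or> (\<exists>X Y. X \<in> H3 \<and> Y \<in> H3 \<and> X \<noteq> Y \<and> e = {X, Y} \<and> S = geod_seg X Y)"
proof -
  define J where "J = {t \<in> {0..1}. (1 - t) * a0 + t * a1 \<le> w \<and> w \<le> (1 - t) * b0 + t * b1}"
  have S: "S = pt w ` J"
    unfolding S_def J_def geod_seg_level[OF w(1,2) order_refl zero_less_one order_refl]
    using trapezoid_region[OF a b ab w(1,2)] by auto
  consider "J = {}" "cut_params w a0 a1 b0 b1 = {}"
    | t1 t2 where "0 \<le> t1" "t1 < t2" "t2 \<le> 1" "J = {t1..t2}" "cut_params w a0 a1 b0 b1 = {t1, t2}"
    using trapezoid_cut[OF ab w(3-6)] unfolding J_def by blast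
  then show ?thesis
  proof cases
    case 1
    then show ?thesis by (simp add: S e_def)
  next
    case (2 t1 t2)
    have "pt w t1 \<noteq> pt w t2" using pt_inject(2)[of w t1 w t2] w 2 by auto
    moreover have "pt w t1 \<in> H3" "pt w t2 \<in> H3"
      using hnorm_H3[OF future_pt[OF w(1,2)]] 2 unfolding pt_def by auto
    moreover have "S = geod_seg (pt w t1) (pt w t2)"
      using 2 w by (subst geod_seg_level) (auto simp: S)
    moreover have "e = {pt w t1, pt w t2}" by (simp add: e_def 2)
    ultimately show ?thesis by blast
  qed
qed

lemma strip_cut:
  assumes a: "0 < a0" "c * a0 < 1" "0 < a1" "c * a1 < 1"
    and b: "0 < b0" "c * b0 < 1" "0 < b1" "c * b1 < 1"
    and w: "0 < w" "c * w < 1" "w \<noteq> a0" "w \<noteq> a1" "w \<noteq> b0" "w \<noteq> b1"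
    and simple: "simple_quad geod_seg (pt a0 0) (pt a1 1) (pt b1 1) (pt b0 0)"
  defines "S \<equiv> geod_quad_region (pt a0 0) (pt a1 1) (pt b1 1) (pt b0 0) \<inter> geod_seg (pt w 0) (pt w 1)"
    and "e \<equiv> pt w ` cut_params w a0 a1 b0 b1"
  shows "S = {} \<and> e = {} \<or> (\<exists>X Y. X \<in> H3 \<and> Y \<in> H3 \<and> X \<noteq> Y \<and> e = {X, Y} \<and> S = geod_seg X Y)"
  using strip_dichotomy[OF a b simple]
proof (elim disjE conjE)
  assume "a0 < b0" "a1 < b1"
  from strip_cut_ordered[OF a b w this] show ?thesis unfolding S_def e_def .
next
  \<comment> \<open>Reading the quadrilateral backwards exchanges the two non-parallel sides and
    leaves the region and the crossings unchanged.\<close>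
  assume "b0 < a0" "b1 < a1"
  from strip_cut_ordered[OF b a w(1,2,5,6,3,4) this] show ?thesis
    unfolding S_def e_def geod_quad_region_reverse[of "pt a0 0"] cut_params_commute[of w a0] .
qed

section \<open>Points of the normal geodesics in the chart\<close>

definition chart :: "real \<Rightarrow> real" where "chart s = s\<^sup>2 / (1 + c * s\<^sup>2)"

text \<open>This is s A + B / s with A = U + c B, i.e. the point with parameter s on the first
  normal geodesic.\<close>

definition left_pt :: "real \<Rightarrow> cmat" where "left_pt s = comb (s, 1 / s + c * s, 0)"
definition right_pt :: "real \<Rightarrow> cmat" where "right_pt s = comb (s, 0, 1 / s + c * s)"

lemma chart_bounds:
  assumes "s > 0" shows "0 < chart s" "c * chart s < 1" "0 < 1 + c * s\<^sup>2"
proof -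
  show p: "0 < 1 + c * s\<^sup>2" using pos by (simp add: add_pos_nonneg)
  then show "0 < chart s" "c * chart s < 1" using assms by (simp_all add: chart_def divide_less_eq)
qed

lemma chart_diff:
  assumes "s > 0" "t > 0"
  shows "chart s - chart t = (s\<^sup>2 - t\<^sup>2) / ((1 + c * s\<^sup>2) * (1 + c * t\<^sup>2))"
  using chart_bounds(3)[OF assms(1)] chart_bounds(3)[OF assms(2)]
  by (simp add: chart_def diff_frac_eq algebra_simps)

lemma chart_less_iff:
  assumes "s > 0" "t > 0" shows "chart s < chart t \<longleftrightarrow> s < t"
proof -
  have D: "0 < (1 + c * s\<^sup>2) * (1 + c * t\<^sup>2)"
    using chart_bounds(3)[OF assms(1)] chart_bounds(3)[OF assms(2)] by (rule mult_pos_pos)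
  have "chart s < chart t \<longleftrightarrow> chart s - chart t < 0" by simp
  also have "\<dots> \<longleftrightarrow> s\<^sup>2 < t\<^sup>2"
    unfolding chart_diff[OF assms] pos_divide_less_eq[OF D] mult_zero_left by simp
  also have "\<dots> \<longleftrightarrow> s < t" using assms power_mono_iff[of t s 2] by (simp add: not_le[symmetric])
  finally show ?thesis .
qed

lemma strict_between_chart_iff:
  assumes "s > 0" "a > 0" "b > 0" shows "strict_between (chart s) (chart a) (chart b) \<longleftrightarrow> strict_between s a b"
  using assms by (simp add: strict_between_def min_less_iff_disj less_max_iff_disj chart_less_iff)

lemma chart_inj:
  assumes "s > 0" "t > 0" "s \<noteq> t" shows "chart s \<noteq> chart t"
  using chart_less_iff[OF assms(1,2)] chart_less_iff[OF assms(2,1)] assms(3) by auto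

lemma scale_chart:
  assumes "s > 0" shows "((1 + c * s\<^sup>2) / s) * chart s = s" "(1 + c * s\<^sup>2) / s = 1 / s + c * s"
proof -
  have "1 + c * s\<^sup>2 \<noteq> 0" using chart_bounds(3)[OF assms] by (rule less_imp_neq[symmetric])
  then have "((1 + c * s\<^sup>2) / s) * chart s = s\<^sup>2 / s" by (simp only: chart_def) simp
  also have "\<dots> = s" by (simp add: power2_eq_square)
  finally show "((1 + c * s\<^sup>2) / s) * chart s = s" .
  have "c * s\<^sup>2 / s = c * s" by (simp add: power2_eq_square)
  then show "(1 + c * s\<^sup>2) / s = 1 / s + c * s" by (simp only: add_divide_distrib)
qed

lemma left_right_pt_scale:
  assumes "s > 0"
  shows "left_pt s = ((1 + c * s\<^sup>2) / s) *\<^sub>R comb (chart s, 1, 0)"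
    "right_pt s = ((1 + c * s\<^sup>2) / s) *\<^sub>R comb (chart s, 0, 1)"
  unfolding linear_scale[OF linear_comb, symmetric] scaleR_Pair real_scaleR_def scale_chart(1)[OF assms]
  unfolding scale_chart(2)[OF assms] left_pt_def right_pt_def by simp_all

lemma left_right_H3:
  assumes "s > 0" shows "left_pt s \<in> H3" "right_pt s \<in> H3"
proof -
  have "future (left_pt s)" "future (right_pt s)"
    unfolding left_pt_def right_pt_def using assms pos by (auto intro!: future_comb add_nonneg_nonneg)
  moreover have "Re (det (left_pt s)) = 1" "Re (det (right_pt s)) = 1"
    using assms by (simp_all add: left_pt_def right_pt_def det_comb power2_eq_square algebra_simps)
  ultimately show "left_pt s \<in> H3" "right_pt s \<in> H3" by (simp_all add: H3_iff)
qed

lemma pt_chart: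
  assumes "s > 0" shows "pt (chart s) 0 = left_pt s" "pt (chart s) 1 = right_pt s"
proof -
  have r: "(1 + c * s\<^sup>2) / s > 0" using assms chart_bounds by simp
  show "pt (chart s) 0 = left_pt s"
    using hnorm_scaleR[OF r, of "comb (chart s, 1, 0)"] hnorm_id[OF left_right_H3(1)[OF assms]]
    unfolding left_right_pt_scale(1)[OF assms] pt_def by simp
  show "pt (chart s) 1 = right_pt s"
    using hnorm_scaleR[OF r, of "comb (chart s, 0, 1)"] hnorm_id[OF left_right_H3(2)[OF assms]]
    unfolding left_right_pt_scale(2)[OF assms] pt_def by simp
qed

text \<open>The weights in \<^const>\<open>side_point\<close> do not involve \<open>c\<close>, i.e. they are the same in the two
  strips that share a side. This is why a parallel surface continues across that side.\<close>

lemma side_point_eq: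
  assumes s: "s > 0" "a > 0" "b > 0" and btw: "strict_between s a b"
  shows "side_point (left_pt a) (right_pt b) a b s = pt (chart s) (level (chart s) (chart a) (chart b))"
proof -
  define t where "t = level (chart s) (chart a) (chart b)"
  \<comment> \<open>A positive common factor that clears the denominators of 1 - t and t;
    \<open>hnorm\<close> forgets it.\<close>
  define K where "K = (1 + c * a\<^sup>2) * (1 + c * b\<^sup>2) * (1 + c * s\<^sup>2) * \<bar>chart b - chart a\<bar>"
  have p: "0 < 1 + c * a\<^sup>2" "0 < 1 + c * b\<^sup>2" "0 < 1 + c * s\<^sup>2" using chart_bounds s by auto
  have btw': "strict_between (chart s) (chart a) (chart b)" using btw strict_between_chart_iff s by simp
  have ne: "chart a \<noteq> chart b" using btw' by (auto simp: strict_between_def)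
  have K: "K > 0" using p ne by (simp add: K_def)
  note t1 = level_weights(1)[OF btw', folded t_def] and t2 = level_weights(2)[OF btw', folded t_def]
  have *: "(1 + c * x\<^sup>2) * (1 + c * y\<^sup>2) * \<bar>chart x - chart y\<bar> = \<bar>x\<^sup>2 - y\<^sup>2\<bar>" if "x > 0" "y > 0" for x y
    using chart_bounds(3)[OF that(1)] chart_bounds(3)[OF that(2)]
    by (simp add: chart_diff[OF that] abs_mult)
  have A: "K * (1 - t) = (1 + c * a\<^sup>2) * \<bar>b\<^sup>2 - s\<^sup>2\<bar>"
    using *[OF s(3,1)] t2 by (simp add: K_def mult.assoc mult.left_commute)
  have B: "K * t = (1 + c * b\<^sup>2) * \<bar>s\<^sup>2 - a\<^sup>2\<bar>"
    using *[OF s(1,2)] t1 by (simp add: K_def mult.assoc mult.left_commute)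
  have lev: "(1 - t) * chart a + t * chart b = chart s" unfolding t_def by (rule level_eq[OF ne])
  have "(a * \<bar>b\<^sup>2 - s\<^sup>2\<bar>) *\<^sub>R left_pt a = (K * (1 - t)) *\<^sub>R comb (chart a, 1, 0)"
    using s by (simp add: left_right_pt_scale(1) A mult.commute)
  moreover have "(b * \<bar>s\<^sup>2 - a\<^sup>2\<bar>) *\<^sub>R right_pt b = (K * t) *\<^sub>R comb (chart b, 0, 1)"
    using s by (simp add: left_right_pt_scale(2) B mult.commute)
  moreover have "(K * (1 - t)) *\<^sub>R comb (chart a, 1, 0) + (K * t) *\<^sub>R comb (chart b, 0, 1) =
      K *\<^sub>R comb ((1 - t) * chart a + t * chart b, 1 - t, t)"
    by (simp add: comb_def algebra_simps)
  ultimately have "side_point (left_pt a) (right_pt b) a b s = hnorm (K *\<^sub>R comb (chart s, 1 - t, t))"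
    by (simp add: side_point_def lev)
  then show ?thesis unfolding hnorm_scaleR[OF K] pt_def t_def .
qed

lemma level_pt_in_seg:
  assumes "0 < a" "c * a < 1" "0 < b" "c * b < 1" "x \<in> {0..1}" "y \<in> {0..1}" "strict_between w a b"
  shows "pt w ((1 - level w a b) * x + level w a b * y) \<in> geod_seg (pt a x) (pt b y)"
proof -
  have ab: "a \<noteq> b" using assms by (auto simp: strict_between_def)
  have "a < w \<and> w < b \<or> b < w \<and> w < a" using assms(7) by (auto simp: strict_between_def)
  then have "level w a b \<in> {0..1}"
    using level_bounds[of a w b] level_bounds'[of b w a] by (elim disjE) simp_all
  moreover have "pt w ((1 - level w a b) * x + level w a b * y) =
      pt ((1 - level w a b) * a + level w a b * b) ((1 - level w a b) * x + level w a b * y)"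
    by (simp only: level_eq[OF ab])
  ultimately show ?thesis using assms(1-6) by (subst geod_seg_pt) auto
qed

lemma crossing_in_side:
  assumes s: "s > 0" "a > 0" "b > 0" and btw: "strict_between s a b"
  shows "left_pt s \<in> geod_seg (left_pt a) (left_pt b)"
    "right_pt s \<in> geod_seg (right_pt a) (right_pt b)"
    "side_point (left_pt a) (right_pt b) a b s \<in> geod_seg (left_pt a) (right_pt b)"
proof -
  have btw': "strict_between (chart s) (chart a) (chart b)" using btw strict_between_chart_iff s by simp
  note * = level_pt_in_seg[OF chart_bounds(1,2)[OF s(2)] chart_bounds(1,2)[OF s(3)] _ _ btw']
  show "left_pt s \<in> geod_seg (left_pt a) (left_pt b)" using *[of 0 0] s by (simp add: pt_chart)
  show "right_pt s \<in> geod_seg (right_pt a) (right_pt b)" using *[of 1 1] s by (simp add: pt_chart)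
  show "side_point (left_pt a) (right_pt b) a b s \<in> geod_seg (left_pt a) (right_pt b)"
    using *[of 0 1] s by (simp add: pt_chart side_point_eq[OF s btw])
qed

text \<open>The chart is strictly increasing, so \<open>strip_cut\<close> can be restated with
  parameters on the normal geodesics alone. In this form the crossings no longer refer to c and can
  be compared between neighbouring faces.\<close>

lemma face_cut:
  assumes s: "s > 0" "a0 > 0" "a1 > 0" "b0 > 0" "b1 > 0"
    and ne: "s \<noteq> a0" "s \<noteq> a1" "s \<noteq> b0" "s \<noteq> b1"
    and simple: "simple_quad geod_seg (left_pt a0) (right_pt a1) (right_pt b1) (left_pt b0)"
  defines "S \<equiv> geod_quad_region (left_pt a0) (right_pt a1) (right_pt b1) (left_pt b0) \<inter>
      geod_seg (left_pt s) (right_pt s)"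
    and "e \<equiv> {v. v = left_pt s \<and> strict_between s a0 b0 \<or> v = right_pt s \<and> strict_between s a1 b1 \<or>
      v = side_point (left_pt a0) (right_pt a1) a0 a1 s \<and> strict_between s a0 a1 \<or>
      v = side_point (left_pt b0) (right_pt b1) b0 b1 s \<and> strict_between s b0 b1}"
  shows "S = {} \<and> e = {} \<or> (\<exists>X Y. X \<in> H3 \<and> Y \<in> H3 \<and> X \<noteq> Y \<and> e = {X, Y} \<and> S = geod_seg X Y)"
proof -
  have e: "e = pt (chart s) ` cut_params (chart s) (chart a0) (chart a1) (chart b0) (chart b1)"
  proof -
    have im: "f ` {t. t = 0 \<and> P \<or> t = 1 \<and> P' \<or> t = x \<and> R \<or> t = y \<and> R'} =
        {v. v = f 0 \<and> P \<or> v = f 1 \<and> P' \<or> v = f x \<and> R \<or> v = f y \<and> R'}"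
      for f :: "real \<Rightarrow> cmat" and x y P P' R R' by auto
    have 1: "v = side_point (left_pt a0) (right_pt a1) a0 a1 s \<and> strict_between s a0 a1 \<longleftrightarrow>
        v = pt (chart s) (level (chart s) (chart a0) (chart a1)) \<and> strict_between s a0 a1" for v
      using side_point_eq[OF s(1-3)] by metis
    have 2: "v = side_point (left_pt b0) (right_pt b1) b0 b1 s \<and> strict_between s b0 b1 \<longleftrightarrow>
        v = pt (chart s) (level (chart s) (chart b0) (chart b1)) \<and> strict_between s b0 b1" for v
      using side_point_eq[OF s(1,4,5)] by metis
    show ?thesis
      unfolding e_def cut_params_def im pt_chart[OF s(1)] 1 2 strict_between_chart_iff[OF s(1,2,3)]
        strict_between_chart_iff[OF s(1,4,5)] strict_between_chart_iff[OF s(1,2,4)] strict_between_chart_iff[OF s(1,3,5)] ..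
  qed
  show ?thesis
    using strip_cut[OF chart_bounds(1,2)[OF s(2)] chart_bounds(1,2)[OF s(3)] chart_bounds(1,2)[OF s(4)]
        chart_bounds(1,2)[OF s(5)] chart_bounds(1,2)[OF s(1)] chart_inj[OF s(1,2) ne(1)]
        chart_inj[OF s(1,3) ne(2)] chart_inj[OF s(1,4) ne(3)] chart_inj[OF s(1,5) ne(4)]]
      simple
    unfolding e S_def by (simp only: pt_chart s)
qed

end

section \<open>Flat surfaces and their caustics\<close>

lemma herm_light: "herm (light_plus E) = light_plus E" "herm (light_minus E) = light_minus E"
proof -
  have "herm (mat2 1 0 0 0) = mat2 1 0 0 0" "herm (mat2 0 0 0 1) = mat2 0 0 0 1"
    by (simp_all add: cmat_eq_iff)
  then show "herm (light_plus E) = light_plus E" "herm (light_minus E) = light_minus E"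
    by (simp_all add: light_plus_def light_minus_def herm_sandwich)
qed

lemma herm_diff_scaleR: "herm (A - r *\<^sub>R B) = herm A - r *\<^sub>R herm B"
  by (simp add: herm_def vec_eq_iff)

text \<open>For a horizontal edge 0 < \<kappa> < 1 makes c and k positive. By
  \<open>light_step_eq\<close> the vector U is the same seen from either end, which is what
  identifies \<open>right_pt\<close> with the normal geodesic at the far end.\<close>

lemma normal_strip_edge:
  assumes E: "pos_det E" and F: "pos_det (E ** mat2 1 h (of_real \<kappa> / h) 1)" and h: "h \<noteq> 0" and \<kappa>: "0 < \<kappa>" "\<kappa> < 1"
  defines "c \<equiv> \<kappa> / (cmod h)\<^sup>2" and "F \<equiv> E ** mat2 1 h (of_real \<kappa> / h) 1"
  defines "U \<equiv> light_plus E - c *\<^sub>R light_minus E"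
  shows "normal_strip U (light_minus E) (light_minus F) c ((cmod h)\<^sup>2 / (1 - \<kappa>))"
    and "normal_strip.left_pt U (light_minus E) (light_minus F) c s = normal_point E s"
    and "normal_strip.right_pt U (light_minus E) (light_minus F) c s = normal_point F s"
proof -
  have U: "U = light_plus F - c *\<^sub>R light_minus F"
    unfolding U_def c_def F_def by (rule light_step_eq[OF E h \<kappa>(2), symmetric])
  have F': "pos_det F" using F by (simp add: F_def)
  show strip: "normal_strip U (light_minus E) (light_minus F) c ((cmod h)\<^sup>2 / (1 - \<kappa>))"
  proof
    show "herm U = U" "herm (light_minus E) = light_minus E" "herm (light_minus F) = light_minus F"
      by (simp_all add: U_def herm_diff_scaleR herm_light)
    show "det (x *\<^sub>R U + y *\<^sub>R light_minus E + z *\<^sub>R light_minus F) =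
        of_real (x * (y + z) - c * x\<^sup>2 + (cmod h)\<^sup>2 / (1 - \<kappa>) * y * z)" for x y z
      unfolding U_def c_def F_def by (rule det_light_span[OF E h \<kappa>(2)])
    show "0 < c" "0 < (cmod h)\<^sup>2 / (1 - \<kappa>)" using h \<kappa> by (simp_all add: c_def)
    show "0 < Re (trace (light_minus E))" "0 < Re (trace (light_minus F))"
      by (rule trace_light(2)[OF E], rule trace_light(2)[OF F'])
    have "U + c *\<^sub>R light_minus E = light_plus E" "U + c *\<^sub>R light_minus F = light_plus F"
      by (simp add: U_def, simp add: U)
    then show "0 < Re (trace (U + c *\<^sub>R light_minus E))" "0 < Re (trace (U + c *\<^sub>R light_minus F))"
      using trace_light(1)[OF E] trace_light(1)[OF F'] by simp_all
  qed
  show "normal_strip.left_pt U (light_minus E) (light_minus F) c s = normal_point E s"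
    unfolding normal_strip.left_pt_def[OF strip] normal_strip.comb_def[OF strip] normal_point_def
    by (simp add: U_def algebra_simps)
  show "normal_strip.right_pt U (light_minus E) (light_minus F) c s = normal_point F s"
    unfolding normal_strip.right_pt_def[OF strip] normal_strip.comb_def[OF strip] normal_point_def
    by (simp add: U algebra_simps)
qed

text \<open>A vertex of the caustic lies at the same parameter \<open>\<sigma>\<close> on both normal geodesics through it.\<close>

definition caustic_param :: "(grid \<Rightarrow> complex) \<Rightarrow> (grid set \<Rightarrow> real) \<Rightarrow> real \<Rightarrow> grid \<Rightarrow> real" where
  "caustic_param g \<alpha> l p = cmod (g (p + (0, 1)) - g p) / sqrt (- (l * \<alpha> {p, p + (0, 1)}))"

locale flat_surface =
  fixes D :: "grid set" and g :: "grid \<Rightarrow> complex" and \<alpha> :: "grid set \<Rightarrow> real"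
    and l :: real and E :: "grid \<Rightarrow> cmat"
  assumes g_adj: "\<And>p q. adjacent_in D p q \<Longrightarrow> g p \<noteq> g q"
    and frame: "flat_surface_frame D g \<alpha> l E"
    and sign_h: "\<And>p. h_edge D p \<Longrightarrow> l * \<alpha> {p, p + (1, 0)} > 0"
    and sign_v: "\<And>p. v_edge D p \<Longrightarrow> l * \<alpha> {p, p + (0, 1)} < 0"
begin

abbreviation "\<sigma> \<equiv> caustic_param g \<alpha> l"

lemma pos_det_frame: "p \<in> D \<Longrightarrow> pos_det (E p)"
  using frame by (simp add: flat_surface_frame_def pos_det_def)

text \<open>The bound on \<lambda>\<alpha> comes from the determinants: det E is positive at both
  ends, and their quotient is 1 - \<lambda>\<alpha>.\<close>

lemma frame_step:
  assumes "p \<in> D" "q \<in> D" "q = p + (1, 0) \<or> q = p + (0, 1)"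
  shows "E q = E p ** mat2 1 (g q - g p) (of_real (l * \<alpha> {p, q}) / (g q - g p)) 1"
    and "g q - g p \<noteq> 0" and "l * \<alpha> {p, q} < 1"
proof -
  define h where "h = g q - g p"
  define \<kappa> where "\<kappa> = l * \<alpha> {p, q}"
  have "adjacent_in D p q" using assms by (auto simp: adjacent_in_def)
  then show h: "g q - g p \<noteq> 0" using g_adj[of p q] by auto
  have "E q - E p = E p ** mat2 0 h (of_real \<kappa> / h) 0"
    using frame assms unfolding flat_surface_frame_def h_def \<kappa>_def by blast
  then have "E q = E p ** mat2 0 h (of_real \<kappa> / h) 0 + E p" by (metis diff_add_cancel)
  also have "\<dots> = E p ** mat2 1 h (of_real \<kappa> / h) 1"
    by (simp add: cmat_eq_iff cmat_mult_nth)
  finally have E: "E q = E p ** mat2 1 h (of_real \<kappa> / h) 1" .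
  then show "E q = E p ** mat2 1 (g q - g p) (of_real (l * \<alpha> {p, q}) / (g q - g p)) 1"
    by (simp only: h_def \<kappa>_def)
  have "det (mat2 1 h (of_real \<kappa> / h) 1) = of_real (1 - \<kappa>)" using h by (simp add: det_2 h_def)
  then have "det (E q) = det (E p) * of_real (1 - \<kappa>)" by (simp only: E det_mul)
  then have "Re (det (E q)) = Re (det (E p)) * (1 - \<kappa>)"
    by (simp del: of_real_diff)
  moreover have "0 < Re (det (E q))" "0 < Re (det (E p))"
    using pos_det_frame assms by (auto simp: pos_det_def)
  ultimately show "l * \<alpha> {p, q} < 1" by (simp add: zero_less_mult_iff \<kappa>_def)
qed

text \<open>Everything follows from \<open>normal_points_meet\<close>. The last claim says that a
  parallel surface takes equal values at the two ends of a vertical edge exactly when it passes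
  through the caustic vertex there.\<close>

lemma caustic_eq:
  assumes v: "v_edge D p"
  shows "0 < \<sigma> p" "caustic E p = normal_point (E p) (\<sigma> p)" "caustic E p = normal_point (E (p + (0, 1))) (\<sigma> p)"
    and "s > 0 \<Longrightarrow> normal_point (E p) s = normal_point (E (p + (0, 1))) s \<longleftrightarrow> s = \<sigma> p"
proof -
  define q where "q = p + (0, 1)"
  have D: "p \<in> D" "q \<in> D" using v by (auto simp: v_edge_def q_def)
  have "q = p + (1, 0) \<or> q = p + (0, 1)" by (simp add: q_def)
  note fs = frame_step[OF D this]
  have k: "l * \<alpha> {p, q} < 0" using sign_v[OF v] by (simp add: q_def)
  have \<sigma>: "\<sigma> p = cmod (g q - g p) / sqrt (- (l * \<alpha> {p, q}))" by (simp add: caustic_param_def q_def)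
  show pos: "0 < \<sigma> p" using fs(2) k unfolding \<sigma> by simp
  have meet: "normal_point (E p) s = normal_point (E q) t \<longleftrightarrow> s = \<sigma> p \<and> t = \<sigma> p" if "s > 0" "t > 0" for s t
    using normal_points_meet[OF pos_det_frame[OF D(1)] fs(2) k that] unfolding fs(1)[symmetric] \<sigma> .
  show "normal_point (E p) s = normal_point (E (p + (0, 1))) s \<longleftrightarrow> s = \<sigma> p" if "s > 0"
    using meet[OF that that] by (simp add: q_def)
  have eq: "normal_point (E p) (\<sigma> p) = normal_point (E q) (\<sigma> p)" using meet[OF pos pos] by simp
  have "caustic E p = normal_point (E p) (\<sigma> p)"
    unfolding caustic_def normal_geodesic_eq q_def[symmetric]
  proof (rule the_equality)
    show "normal_point (E p) (\<sigma> p) \<in> normal_point (E p) ` {0<..} \<inter> normal_point (E q) ` {0<..}"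
      using pos eq by (metis IntI greaterThan_iff imageI)
    fix X assume "X \<in> normal_point (E p) ` {0<..} \<inter> normal_point (E q) ` {0<..}"
    then obtain s t where st: "s > 0" "t > 0" "X = normal_point (E p) s" "X = normal_point (E q) t" by auto
    then show "X = normal_point (E p) (\<sigma> p)" using meet[OF st(1,2)] by simp
  qed
  then show "caustic E p = normal_point (E p) (\<sigma> p)" "caustic E p = normal_point (E (p + (0, 1))) (\<sigma> p)"
    using eq by (simp_all add: q_def)
qed

text \<open>The crossings with the left, right, lower and upper side of the face, in this order.
  Lower and upper sides are both read from left to right, so that neighbouring faces describe a
  shared crossing by the same term.\<close>

definition cut_ends :: "real \<Rightarrow> grid \<Rightarrow> cmat set" where
  "cut_ends s p = {v.
     v = normal_point (E p) s \<and> strict_between s (\<sigma> (p - (0, 1))) (\<sigma> p) \<or>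
     v = normal_point (E (p + (1, 0))) s \<and> strict_between s (\<sigma> (p + (1, 0) - (0, 1))) (\<sigma> (p + (1, 0))) \<or>
     v = side_point (caustic E (p - (0, 1))) (caustic E (p + (1, 0) - (0, 1)))
           (\<sigma> (p - (0, 1))) (\<sigma> (p + (1, 0) - (0, 1))) s \<and>
         strict_between s (\<sigma> (p - (0, 1))) (\<sigma> (p + (1, 0) - (0, 1))) \<or>
     v = side_point (caustic E p) (caustic E (p + (1, 0))) (\<sigma> p) (\<sigma> (p + (1, 0))) s \<and>
         strict_between s (\<sigma> p) (\<sigma> (p + (1, 0)))}"

lemma face_edges_D:
  assumes "p \<in> caustic_face_edges D"
  shows "p \<in> D" "p + (1, 0) \<in> D" "h_edge D p" "v_edge D (p - (0, 1))" "v_edge D (p + (1, 0) - (0, 1))"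
    "v_edge D (p + (1, 0))" "v_edge D p"
  using assms by (auto simp: caustic_face_edges_def h_edge_def)

lemma cut_face:
  assumes p: "p \<in> caustic_face_edges D" and simple: "caustic_face_embedded E p" and s: "s > 0"
    and ne: "\<And>r. v_edge D r \<Longrightarrow> s \<noteq> \<sigma> r"
  defines "S \<equiv> caustic_face E p \<inter> geod_seg (normal_point (E p) s) (normal_point (E (p + (1, 0))) s)"
  shows "S = {} \<and> cut_ends s p = {} \<or>
      (\<exists>X Y. X \<in> H3 \<and> Y \<in> H3 \<and> X \<noteq> Y \<and> cut_ends s p = {X, Y} \<and> S = geod_seg X Y)" (is ?A)
    and "strict_between s (\<sigma> (p - (0, 1))) (\<sigma> p) \<Longrightarrow>
      normal_point (E p) s \<in> geod_seg (caustic E p) (caustic E (p - (0, 1)))" (is "?P1 \<Longrightarrow> ?Q1")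
    and "strict_between s (\<sigma> (p + (1, 0) - (0, 1))) (\<sigma> (p + (1, 0))) \<Longrightarrow>
      normal_point (E (p + (1, 0))) s \<in> geod_seg (caustic E (p + (1, 0) - (0, 1))) (caustic E (p + (1, 0)))" (is "?P2 \<Longrightarrow> ?Q2")
    and "strict_between s (\<sigma> (p - (0, 1))) (\<sigma> (p + (1, 0) - (0, 1))) \<Longrightarrow>
      side_point (caustic E (p - (0, 1))) (caustic E (p + (1, 0) - (0, 1)))
           (\<sigma> (p - (0, 1))) (\<sigma> (p + (1, 0) - (0, 1))) s
        \<in> geod_seg (caustic E (p - (0, 1))) (caustic E (p + (1, 0) - (0, 1)))" (is "?P3 \<Longrightarrow> ?Q3")
    and "strict_between s (\<sigma> p) (\<sigma> (p + (1, 0))) \<Longrightarrow>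
      side_point (caustic E p) (caustic E (p + (1, 0))) (\<sigma> p) (\<sigma> (p + (1, 0))) s
        \<in> geod_seg (caustic E (p + (1, 0))) (caustic E p)" (is "?P4 \<Longrightarrow> ?Q4")
proof -
  define q where "q = p + (1, 0)"
  define a where "a = p - (0, 1)"
  define b where "b = q - (0, 1)"
  have p_eq: "p = a + (0, 1)" and q_eq: "q = b + (0, 1)" by (simp_all add: a_def b_def)
  note D = face_edges_D[OF p, folded q_def, folded a_def b_def]
  have "q = p + (1, 0) \<or> q = p + (0, 1)" by (simp add: q_def)
  note fs = frame_step[OF D(1,2) this]
  have k: "0 < l * \<alpha> {p, q}" using sign_h[OF D(3)] by (simp add: q_def)
  have F: "pos_det (E p ** mat2 1 (g q - g p) (of_real (l * \<alpha> {p, q}) / (g q - g p)) 1)"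
    using pos_det_frame[OF D(2)] unfolding fs(1) .
  note strip = normal_strip_edge[OF pos_det_frame[OF D(1)] F fs(2) k fs(3), folded fs(1)]
  define U where "U = light_plus (E p) - (l * \<alpha> {p, q} / (cmod (g q - g p))\<^sup>2) *\<^sub>R light_minus (E p)"
  define c where "c = l * \<alpha> {p, q} / (cmod (g q - g p))\<^sup>2"
  note strip = strip[folded c_def, folded U_def[folded c_def]]
  have left: "normal_strip.left_pt U (light_minus (E p)) (light_minus (E q)) c t = normal_point (E p) t" for t
    by (rule strip(2))
  have right: "normal_strip.right_pt U (light_minus (E p)) (light_minus (E q)) c t = normal_point (E q) t" for t
    by (rule strip(3))
  interpret N: normal_strip U "light_minus (E p)" "light_minus (E q)" c "(cmod (g q - g p))\<^sup>2 / (1 - l * \<alpha> {p, q})"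
    by (rule strip(1))
  note c1 = caustic_eq[OF D(4)] and c2 = caustic_eq[OF D(5)] and c3 = caustic_eq[OF D(6)] and c4 = caustic_eq[OF D(7)]
  \<comment> \<open>The lower corners belong to the vertical edges below p and q. Expressing them by
    the frames at the upper ends of these edges puts all four corners on the normal geodesics at p
    and q.\<close>
  have ca: "caustic E a = normal_point (E p) (\<sigma> a)" using c1(3) by (simp only: p_eq[symmetric])
  have cb: "caustic E b = normal_point (E q) (\<sigma> b)" using c2(3) by (simp only: q_eq[symmetric])
  have simple': "simple_quad geod_seg (N.left_pt (\<sigma> a)) (N.right_pt (\<sigma> b)) (N.right_pt (\<sigma> q)) (N.left_pt (\<sigma> p))"
    using simple unfolding caustic_face_embedded_def q_def[symmetric] a_def[symmetric] b_def[symmetric]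
      left right ca cb c3(2) c4(2) .
  note ne' = ne[OF D(4)] ne[OF D(5)] ne[OF D(7)] ne[OF D(6)]
  note fold_defs = q_def[symmetric] a_def[symmetric] b_def[symmetric]
  show ?A
    using N.face_cut[OF s c1(1) c2(1) c4(1) c3(1) ne' simple']
    unfolding S_def cut_ends_def caustic_face_def fold_defs left right ca cb c3(2) c4(2) .
  show "?P1 \<Longrightarrow> ?Q1"
    using N.crossing_in_side(1)[OF s c1(1) c4(1)]
    unfolding fold_defs left right ca cb c3(2) c4(2) geod_seg_commute[of "normal_point (E p) (\<sigma> p)"] .
  show "?P2 \<Longrightarrow> ?Q2"
    using N.crossing_in_side(2)[OF s c2(1) c3(1)]
    unfolding fold_defs left right ca cb c3(2) c4(2) .
  show "?P3 \<Longrightarrow> ?Q3"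
    using N.crossing_in_side(3)[OF s c1(1) c2(1)]
    unfolding fold_defs left right ca cb c3(2) c4(2) .
  show "?P4 \<Longrightarrow> ?Q4"
    using N.crossing_in_side(3)[OF s c4(1) c3(1)]
    unfolding fold_defs left right ca cb c3(2) c4(2) geod_seg_commute[of "normal_point (E q) (\<sigma> q)"] .
qed

text \<open>Each crossing reappears in the face on the other side with the opposite role: left as
  right, lower as upper, and conversely. If that face is absent, the side is a boundary side and
  \<open>cut_face\<close> places the crossing on it.\<close>

lemma cut_ends_neighbour:
  assumes p: "p \<in> caustic_face_edges D" and simple: "caustic_face_embedded E p" and s: "s > 0"
    and ne: "\<And>r. v_edge D r \<Longrightarrow> s \<noteq> \<sigma> r" and v: "v \<in> cut_ends s p"
  shows "v \<in> caustic_boundary_sides D E p \<or> (\<exists>r \<in> caustic_face_edges D. r \<noteq> p \<and> v \<in> cut_ends s r)"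
proof -
  obtain m n where mn: "p = (m, n)" by (cases p)
  note cut = cut_face(2-5)[OF p simple s ne]
  from v[unfolded cut_ends_def mem_Collect_eq] show ?thesis
  proof (elim disjE conjE)
    assume h: "v = normal_point (E p) s" "strict_between s (\<sigma> (p - (0, 1))) (\<sigma> p)"
    show ?thesis
    proof (cases "p - (1, 0) \<in> caustic_face_edges D")
      case True
      have "v \<in> cut_ends s (p - (1, 0))" using h by (simp add: cut_ends_def)
      with True show ?thesis by (intro disjI2 bexI[of _ "p - (1, 0)"]) (auto simp: mn)
    next
      case False
      with cut(1) h show ?thesis by (simp add: caustic_boundary_sides_def Let_def)
    qed
  next
    assume h: "v = normal_point (E (p + (1, 0))) s"
      "strict_between s (\<sigma> (p + (1, 0) - (0, 1))) (\<sigma> (p + (1, 0)))"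
    show ?thesis
    proof (cases "p + (1, 0) \<in> caustic_face_edges D")
      case True
      have "v \<in> cut_ends s (p + (1, 0))" using h by (simp add: cut_ends_def)
      with True show ?thesis by (intro disjI2 bexI[of _ "p + (1, 0)"]) (auto simp: mn)
    next
      case False
      with cut(2) h show ?thesis by (simp add: caustic_boundary_sides_def Let_def)
    qed
  next
    assume h: "v = side_point (caustic E (p - (0, 1))) (caustic E (p + (1, 0) - (0, 1)))
           (\<sigma> (p - (0, 1))) (\<sigma> (p + (1, 0) - (0, 1))) s"
      "strict_between s (\<sigma> (p - (0, 1))) (\<sigma> (p + (1, 0) - (0, 1)))"
    show ?thesis
    proof (cases "p - (0, 1) \<in> caustic_face_edges D")
      case True
      have eq: "p + (1, 0) - (0, 1) = p - (0, 1) + (1, 0)" by (simp add: mn)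
      have "v \<in> cut_ends s (p - (0, 1))" using h unfolding cut_ends_def eq by blast
      with True show ?thesis by (intro disjI2 bexI[of _ "p - (0, 1)"]) (auto simp: mn)
    next
      case False
      with cut(3) h show ?thesis by (simp add: caustic_boundary_sides_def Let_def)
    qed
  next
    assume h: "v = side_point (caustic E p) (caustic E (p + (1, 0))) (\<sigma> p) (\<sigma> (p + (1, 0))) s"
      "strict_between s (\<sigma> p) (\<sigma> (p + (1, 0)))"
    show ?thesis
    proof (cases "p + (0, 1) \<in> caustic_face_edges D")
      case True
      have eq: "p + (0, 1) + (1, 0) - (0, 1) = p + (1, 0)" "p + (0, 1) - (0, 1) = p" by (simp_all add: mn)
      have "v \<in> cut_ends s (p + (0, 1))" using h unfolding cut_ends_def eq by blast
      with True show ?thesis by (intro disjI2 bexI[of _ "p + (0, 1)"]) (auto simp: mn)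
    next
      case False
      with cut(4) h show ?thesis by (simp add: caustic_boundary_sides_def Let_def)
    qed
  qed
qed

end

section \<open>The graph and its valences\<close>

lemma valence_ge_2:
  assumes "p \<in> I" "r \<in> I" "r \<noteq> p" "v \<in> ends p" "v \<in> ends r"
  shows "2 \<le> valence I ends v"
proof (cases "finite {e \<in> I. v \<in> ends e}")
  case True
  then have "card {p, r} \<le> card {e \<in> I. v \<in> ends e}" using assms by (intro card_mono) auto
  then have "enat 2 \<le> enat (card {e \<in> I. v \<in> ends e})" using assms(3) by simp
  then show ?thesis using True by (simp add: valence_def numeral_eq_enat)
qed (simp add: valence_def)

theorem theorem7p3:
  fixes D :: "grid set" and g :: "grid \<Rightarrow> complex" and \<alpha> :: "grid set \<Rightarrow> real"
    and l d :: real and E :: "grid \<Rightarrow> cmat"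
  assumes hol: "discrete_holomorphic D g \<alpha>"
    and quads: "properly_embedded_quads D g"
    and l: "l \<noteq> 0"
    and frame: "flat_surface_frame D g \<alpha> l E"
    and sign_h: "\<And>p. h_edge D p \<Longrightarrow> l * \<alpha> {p, p + (1, 0)} > 0"
    and sign_v: "\<And>p. v_edge D p \<Longrightarrow> l * \<alpha> {p, p + (0, 1)} < 0"
    and d: "d > 0"
    and distinct: "\<And>p q. adjacent_in D p q \<Longrightarrow> parallel_surf E d p \<noteq> parallel_surf E d q"
    and faces: "\<And>p. p \<in> caustic_face_edges D \<Longrightarrow> caustic_face_embedded E p"
  shows "\<exists>(V :: cmat set) (I :: grid set) (ends :: grid \<Rightarrow> cmat set).
      graph V I ends \<and>
      I = {p \<in> caustic_face_edges D. S_part E d p \<noteq> {}} \<and>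
      (\<forall>p\<in>I. \<exists>X Y. ends p = {X, Y} \<and> S_part E d p = geod_seg X Y) \<and>
      S_set D E d = V \<union> (\<Union>p\<in>I. S_part E d p) \<and>
      (\<forall>v\<in>V. 2 \<le> valence I ends v \<or>
         (\<exists>p\<in>I. v \<in> ends p \<and> v \<in> caustic_boundary_sides D E p))"
proof -
  interpret flat_surface D g \<alpha> l E
  proof
    show "\<And>p q. adjacent_in D p q \<Longrightarrow> g p \<noteq> g q" using hol unfolding discrete_holomorphic_def by blast
  qed (fact frame sign_h sign_v)+
  define s where "s = 1 / d"
  have s: "s > 0" using d by (simp add: s_def)
  have par: "parallel_surf E d p = normal_point (E p) s" for p
    using parallel_surf_eq[OF d] by (simp add: s_def)
  \<comment> \<open>If s were the parameter of a caustic vertex, the parallel surface would take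
    equal values at the two ends of that vertical edge, contrary to \<open>distinct\<close>. Hence
    its edges avoid all corners of the faces.\<close>
  have ne: "s \<noteq> \<sigma> r" if "v_edge D r" for r
  proof -
    have "adjacent_in D r (r + (0, 1))" using that by (auto simp: v_edge_def adjacent_in_def)
    from distinct[OF this] show ?thesis using caustic_eq(4)[OF that s] by (simp add: par)
  qed
  define I where "I = {p \<in> caustic_face_edges D. S_part E d p \<noteq> {}}"
  \<comment> \<open>Vertices are the ends of the nonempty pieces. The pieces are indexed by
    horizontal edges of the grid, so different faces give different edges of the graph even where
    their segments coincide.\<close>
  define V where "V = (\<Union>p\<in>I. cut_ends s p)"
  have S_part: "S_part E d p = {} \<and> cut_ends s p = {} \<or>
      (\<exists>X Y. X \<in> H3 \<and> Y \<in> H3 \<and> X \<noteq> Y \<and> cut_ends s p = {X, Y} \<and> S_part E d p = geod_seg X Y)"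
    if "p \<in> caustic_face_edges D" for p
    using cut_face(1)[OF that faces[OF that] s ne] unfolding S_part_def par .
  have I: "\<exists>X Y. X \<in> H3 \<and> Y \<in> H3 \<and> X \<noteq> Y \<and> cut_ends s p = {X, Y} \<and> S_part E d p = geod_seg X Y"
    if "p \<in> I" for p
    using S_part[of p] that unfolding I_def by blast
  have in_I: "p \<in> I" if "p \<in> caustic_face_edges D" "v \<in> cut_ends s p" for p v
  proof -
    have "S_part E d p \<noteq> {}"
      using S_part[OF that(1)] that(2) geod_seg_ends by blast
    then show ?thesis using that(1) by (simp add: I_def)
  qed
  have ends_sub: "cut_ends s p \<subseteq> S_part E d p" if "p \<in> I" for p
  proof -
    obtain X Y where XY: "X \<in> H3" "Y \<in> H3" "cut_ends s p = {X, Y}" "S_part E d p = geod_seg X Y"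
      using I[OF \<open>p \<in> I\<close>] by blast
    show ?thesis unfolding XY(3,4)
      using geod_seg_ends[OF XY(1), of Y] geod_seg_ends[OF XY(2), of X] geod_seg_commute[of X Y] by simp
  qed
  have "graph V I (cut_ends s)"
    unfolding graph_def
  proof
    fix p assume p: "p \<in> I"
    then obtain X Y where "X \<noteq> Y" "cut_ends s p = {X, Y}" using I by blast
    then have "card (cut_ends s p) = 2" by simp
    with p show "cut_ends s p \<subseteq> V \<and> card (cut_ends s p) = 2" by (auto simp: V_def)
  qed
  moreover have "\<forall>p\<in>I. \<exists>X Y. cut_ends s p = {X, Y} \<and> S_part E d p = geod_seg X Y"
    using I by blast
  moreover have "S_set D E d = V \<union> (\<Union>p\<in>I. S_part E d p)"
  proof -
    have "S_set D E d = (\<Union>p\<in>I. S_part E d p)"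
      by (auto simp: S_set_def I_def S_part_def geod_seg_def)
    moreover have "V \<subseteq> (\<Union>p\<in>I. S_part E d p)" using ends_sub by (auto simp: V_def)
    ultimately show ?thesis by blast
  qed
  moreover have "\<forall>v\<in>V. 2 \<le> valence I (cut_ends s) v \<or>
      (\<exists>p\<in>I. v \<in> cut_ends s p \<and> v \<in> caustic_boundary_sides D E p)"
  proof
    fix v assume "v \<in> V"
    then obtain p where p: "p \<in> I" "v \<in> cut_ends s p" by (auto simp: V_def)
    then have pD: "p \<in> caustic_face_edges D" by (simp add: I_def)
    show "2 \<le> valence I (cut_ends s) v \<or> (\<exists>p\<in>I. v \<in> cut_ends s p \<and> v \<in> caustic_boundary_sides D E p)"
    proof (cases "v \<in> caustic_boundary_sides D E p")
      case True
      with p show ?thesis by blast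
    next
      case False
      \<comment> \<open>The piece continues in the neighbouring face \<open>r\<close>; its cut is
        nonempty because it has \<open>v\<close> as an end, so \<open>r\<close> is a second edge at
        \<open>v\<close>.\<close>
      then obtain r where r: "r \<in> caustic_face_edges D" "r \<noteq> p" "v \<in> cut_ends s r"
        using cut_ends_neighbour[OF pD faces[OF pD] s ne p(2)] by blast
      then show ?thesis using valence_ge_2[OF p(1) in_I[OF r(1,3)] r(2) p(2) r(3)] by simp
    qed
  qed
  ultimately show ?thesis using I_def by (intro exI[of _ V] exI[of _ I] exI[of _ "cut_ends s"] conjI)
qed

end
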